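(* Let $\Omega_1,\Omega_2\subseteq\mathbb{C}$ be open, let $p>2$ and $g\in L^p_{loc}(\Omega_1)$, and suppose there is some $G:\Omega_1\to\mathbb{C}$ such that $G$ is continuous, satisfies condition $( * )$ on $\Omega_1$, and $\frac{\partial G}{\partial\bar z}=g(z)$ almost everywhere. Let $f:\Omega_2\to\mathbb{C}$ be continuous with $f(w_0)=0$ for a point $w_0\in\Omega_2$, and suppose that for some disk $D_{w_0,r}\subseteq\Omega_2$ there is $F:D_{w_0,r}\setminus\{w_0\}\to\mathbb{C}$ such that $F$ is holomorphic and satisfies $F'(w)=\frac1{f(w)}$. For any $z_0\in\Omega_1$, if there exist a neighborhood of $z_0$, $\Omega_1^0\subseteq\Omega_1$, and a non-constant, continuous function $u:\Omega_1^0\to\Omega_2$ satisfying condition $( * )$ on $\Omega_1^0$, $u(z_0)=w_0$, and $\frac{\partial u}{\partial\bar z}=f(u)g(z)$ almost everywhere on $\Omega_1^0$, then there exist an integer $M\ge1$ and a nonvanishing holomorphic function $\phi(z)$ on some neighborhood of $z_0$, with $$(z-z_0)^{M}F(u(z))=\phi(z)+(z-z_0)^{M}G(z)$$ for $z\ne z_0$ in that neighborhood.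
   Context: Write $z=x+iy$. For a complex valued function $v$ on an open set $\Omega\subseteq\mathbb{C}=\mathbb{R}^2$, $v_x,v_y$ denote the pointwise classical partial derivatives, and at points where both exist, $\frac{\partial v}{\partial\bar z}=\frac12(v_x+iv_y)$; this is the pointwise, not the distributional, derivative. Condition $( * )$ for $v$ on $\Omega$: the partial derivatives $v_x$, $v_y$ exist at every point of $\Omega$ except for countably many. $D_{a,r}$ is the open disk in $\mathbb{C}$ with center $a$ and radius $r>0$. Neighborhoods are open.
   Formalization: "Non-constant" is required of u on the connected component of the neighborhood containing z_0; if the neighborhood is disconnected, u could equal w_0 near z_0 and vary elsewhere, and then F(u(z)) is undefined near z_0. *)

theory Defs
  imports "HOL-Complex_Analysis.Complex_Analysis"
begin

text \<open>Pointwise partial derivatives of \<open>v\<close> at \<open>z\<close>, viewed as a function of the two real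
  variables \<open>x = Re z\<close> and \<open>y = Im z\<close>.  When \<open>z\<close> lies in an open set, these depend only on the
  values of \<open>v\<close> on that set.\<close>

definition has_partial_x :: "(complex \<Rightarrow> complex) \<Rightarrow> complex \<Rightarrow> complex \<Rightarrow> bool" where
  "has_partial_x v d z \<longleftrightarrow> ((\<lambda>t. v (z + complex_of_real t)) has_vector_derivative d) (at 0)"

definition has_partial_y :: "(complex \<Rightarrow> complex) \<Rightarrow> complex \<Rightarrow> complex \<Rightarrow> bool" where
  "has_partial_y v d z \<longleftrightarrow> ((\<lambda>t. v (z + \<i> * complex_of_real t)) has_vector_derivative d) (at 0)"

definition partials_exist_off_countable :: "(complex \<Rightarrow> complex) \<Rightarrow> complex set \<Rightarrow> bool" where
  "partials_exist_off_countable v \<Omega> \<longleftrightarrow>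
     countable {z \<in> \<Omega>. \<not> ((\<exists>d. has_partial_x v d z) \<and> (\<exists>d. has_partial_y v d z))}"

text \<open>A relation rather than a total function, so that no value is assigned at points where one
  of the partial derivatives fails to exist.\<close>

definition has_dbar :: "(complex \<Rightarrow> complex) \<Rightarrow> complex \<Rightarrow> complex \<Rightarrow> bool" where
  "has_dbar v c z \<longleftrightarrow>
     (\<exists>dx dy. has_partial_x v dx z \<and> has_partial_y v dy z \<and> c = (1 / 2) * (dx + \<i> * dy))"

definition Lp_loc :: "real \<Rightarrow> complex set \<Rightarrow> (complex \<Rightarrow> complex) set" where
  "Lp_loc p \<Omega> = {g. g \<in> borel_measurable (lebesgue_on \<Omega>) \<and>
     (\<forall>K. compact K \<and> K \<subseteq> \<Omega> \<longrightarrow> integrable (lebesgue_on K) (\<lambda>z. norm (g z) powr p))}"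

end

theory Submission
  imports Defs
begin

text \<open>
  Put \<open>\<kappa> = 1 / F\<close>.  Since \<open>F' = 1 / f\<close> blows up at \<open>w\<^sub>0\<close>, the primitive \<open>F\<close> has a pole there
  (\<open>is_pole_antiderivative\<close>), so \<open>\<kappa>\<close> with \<open>\<kappa> w\<^sub>0 = 0\<close> is holomorphic near \<open>w\<^sub>0\<close>, vanishes only at
  \<open>w\<^sub>0\<close>, and satisfies \<open>\<kappa>' f = -\<kappa>\<^sup>2\<close> throughout, \<open>w\<^sub>0\<close> included.  The function to study is
  \<open>h = 1 / (F(u) - G)\<close>, written as
  \<open>h = \<kappa>(u) / (1 - G \<kappa>(u))\<close>, which makes sense also where \<open>u = w\<^sub>0\<close>.  The quotient rule gives
  \<open>(\<kappa>'(u) f(u) g + \<kappa>(u)\<^sup>2 g) / (1 - G \<kappa>(u))\<^sup>2 = 0\<close> as the d-bar derivative of \<open>h\<close> almost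
  everywhere, and \<open>h\<close> inherits continuity and the existence of partial derivatives off a
  countable set from \<open>u\<close> and \<open>G\<close>.  By the Looman-Menchoff theorem (\<open>looman_menchoff\<close>) \<open>h\<close> is
  holomorphic near every point where \<open>u = w\<^sub>0\<close>.  Because the quotient defining \<open>h\<close> is meaningful
  on the whole zero set of \<open>u - w\<^sub>0\<close>, no information about the shape of that set is needed in
  advance.  The zeros of \<open>h\<close> are the points with \<open>u = w\<^sub>0\<close>; if \<open>h\<close> vanished near \<open>z\<^sub>0\<close>, unique
  continuation, applied to the local functions \<open>h\<close>, would make \<open>u\<close> constant on the component of
  \<open>z\<^sub>0\<close>.  So \<open>h = (z - z\<^sub>0)\<^sup>M \<psi>\<close> with \<open>M \<ge> 1\<close> and \<open>\<psi>\<close> zero-free, and \<open>\<phi> = 1 / \<psi>\<close> works.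
  
  The bulk of the text proves the Looman-Menchoff theorem.  A Baire category argument reduces it
  to a patch on which \<open>v\<close> is \<open>N\<close>-Lipschitz along horizontal and vertical lines through each point
  of the closed set \<open>E\<close> of bad points (\<open>holomorphic_on_if_axis_lipschitz\<close>).  On such a patch
  Menchoff's estimate bounds the boundary integral of \<open>v\<close> over a rectangle \<open>Q\<close> by a constant
  times the measure of \<open>Q - E\<close>, as soon as \<open>Q\<close> meets \<open>E\<close>
  (\<open>norm_rect_integral_le_measure_outside\<close>); rectangles missing \<open>E\<close> contribute nothing.
  Bisecting \<open>Q\<close> repeatedly, only the part of \<open>Q - E\<close> in a thin collar of \<open>E\<close> survives in the
  bound, so every boundary integral is zero and \<open>v\<close> has a holomorphic primitive.
  
  Menchoff's estimate itself compares \<open>v\<close> with a Lipschitz function \<open>g\<close> that agrees with \<open>v\<close> on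
  \<open>K = E \<inter> Q\<close>.  The difference \<open>v - g\<close> on the edges of the smallest rectangle \<open>R\<close> around \<open>K\<close> is
  controlled by the gaps of \<open>K\<close> (\<open>integral_edge_le_measure_gaps\<close>).  The boundary integral of
  \<open>g\<close> is the limit of plane integrals of difference quotients; on \<open>K\<close> these tend to the d-bar
  derivative of \<open>v\<close>, which is zero, and off \<open>K\<close> they are bounded
  (\<open>norm_rect_integral_lipschitz_le\<close>).
\<close>

section \<open>Lipschitz extension\<close>

text \<open>
  The extension is McShane's: the infimum of the cones \<open>\<lambda>x. f k + L * dist x k\<close> over \<open>k \<in> K\<close>.
\<close>

lemma lipschitz_extension_real:
  fixes f :: "'a::metric_space \<Rightarrow> real"
  assumes "K \<noteq> {}" and L: "\<And>x y. x \<in> K \<Longrightarrow> y \<in> K \<Longrightarrow> \<bar>f x - f y\<bar> \<le> L * dist x y" and "0 \<le> L"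
  obtains g where "\<And>x y. \<bar>g x - g y\<bar> \<le> L * dist x y" "\<And>x. x \<in> K \<Longrightarrow> g x = f x"
proof -
  define g where "g x = (INF k\<in>K. f k + L * dist x k)" for x
  have lower: "f k' - L * dist x k' \<le> f k + L * dist x k" if "k \<in> K" "k' \<in> K" for x k k'
  proof -
    have "L * dist k' k \<le> L * (dist x k' + dist x k)"
      using \<open>0 \<le> L\<close> by (intro mult_left_mono) (metis dist_triangle3 dist_commute)
    with L[OF that(2,1)] show ?thesis by (simp add: algebra_simps)
  qed
  have bdd: "bdd_below ((\<lambda>k. f k + L * dist x k) ` K)" for x
    using \<open>K \<noteq> {}\<close> lower by (meson bdd_belowI2 ex_in_conv)
  have one: "g x \<le> g y + L * dist x y" for x y
  proof -
    have "g x - L * dist x y \<le> g y"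
      unfolding g_def[of y]
    proof (rule cINF_greatest[OF \<open>K \<noteq> {}\<close>])
      fix k assume "k \<in> K"
      then have "g x \<le> f k + L * dist x k"
        unfolding g_def by (rule cINF_lower[OF bdd])
      moreover have "L * dist x k \<le> L * (dist x y + dist y k)"
        using \<open>0 \<le> L\<close> by (intro mult_left_mono) (auto simp: dist_triangle)
      ultimately show "g x - L * dist x y \<le> f k + L * dist y k"
        by (simp add: algebra_simps)
    qed
    then show ?thesis by simp
  qed
  have "\<bar>g x - g y\<bar> \<le> L * dist x y" for x y
    using one[of x y] one[of y x] by (simp add: dist_commute abs_le_iff)
  moreover have "g x = f x" if "x \<in> K" for x
  proof (rule antisym)
    show "g x \<le> f x"
      using cINF_lower[OF bdd[of x] that] by (simp add: g_def)
    show "f x \<le> g x"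
      unfolding g_def using lower[OF _ that, of _ x] by (intro cINF_greatest[OF \<open>K \<noteq> {}\<close>]) auto
  qed
  ultimately show thesis by (rule that)
qed

text \<open>
  Extending real and imaginary part separately costs a factor of two in the constant, which is
  irrelevant below.
\<close>

lemma lipschitz_extension_complex:
  fixes f :: "'a::metric_space \<Rightarrow> complex"
  assumes "K \<noteq> {}" and L: "\<And>x y. x \<in> K \<Longrightarrow> y \<in> K \<Longrightarrow> norm (f x - f y) \<le> L * dist x y" and "0 \<le> L"
  obtains g where "\<And>x y. norm (g x - g y) \<le> 2 * L * dist x y" "\<And>x. x \<in> K \<Longrightarrow> g x = f x"
proof -
  obtain g1 where g1: "\<And>x y. \<bar>g1 x - g1 y\<bar> \<le> L * dist x y" "\<And>x. x \<in> K \<Longrightarrow> g1 x = Re (f x)"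
    using lipschitz_extension_real[OF \<open>K \<noteq> {}\<close> _ \<open>0 \<le> L\<close>, of "\<lambda>x. Re (f x)"]
    by (metis L abs_Re_le_cmod minus_complex.simps(1) order.trans)
  obtain g2 where g2: "\<And>x y. \<bar>g2 x - g2 y\<bar> \<le> L * dist x y" "\<And>x. x \<in> K \<Longrightarrow> g2 x = Im (f x)"
    using lipschitz_extension_real[OF \<open>K \<noteq> {}\<close> _ \<open>0 \<le> L\<close>, of "\<lambda>x. Im (f x)"]
    by (metis L abs_Im_le_cmod minus_complex.simps(2) order.trans)
  show thesis
  proof (rule that[of "\<lambda>x. Complex (g1 x) (g2 x)"])
    fix x y
    show "norm (Complex (g1 x) (g2 x) - Complex (g1 y) (g2 y)) \<le> 2 * L * dist x y"
      using cmod_le[of "Complex (g1 x) (g2 x) - Complex (g1 y) (g2 y)"] g1(1)[of x y] g2(1)[of x y]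
      by simp
  qed (auto simp: g1 g2 complex_eq_iff)
qed

section \<open>Deviation along an edge and the gaps of a compact set\<close>

lemma fmeasurable_compact_Diff:
  fixes Q K :: "'a::euclidean_space set"
  assumes "compact Q" "compact K"
  shows "Q - K \<in> fmeasurable lborel"
proof (intro fmeasurableI)
  show "Q - K \<in> sets lborel"
    using assms by (simp add: borel_closed compact_imp_closed sets.Diff)
  show "emeasure lborel (Q - K) < \<infinity>"
    using assms by (intro emeasure_bounded_finite) (meson Diff_subset bounded_subset compact_imp_bounded)
qed

lemma lborel_measure_sections:
  fixes S :: "(real \<times> real) set"
  assumes S: "S \<in> sets borel" "emeasure lborel S < \<infinity>"
  shows "integrable lborel (\<lambda>x. measure lborel {y. (x, y) \<in> S})"
    and "(\<integral>x. measure lborel {y. (x, y) \<in> S} \<partial>lborel) = measure lborel S"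
proof -
  have S': "S \<in> sets (lborel \<Otimes>\<^sub>M lborel)" using S unfolding lborel_prod by simp
  have int: "integrable (lborel \<Otimes>\<^sub>M lborel) (indicator S :: _ \<Rightarrow> real)"
    using S S' unfolding lborel_prod by simp
  have eq: "(\<integral>y. indicator S (x, y) \<partial>lborel) = measure lborel {y. (x, y) \<in> S}" for x
  proof -
    have "(\<integral>y. indicator S (x, y) \<partial>lborel) = (\<integral>y. (indicator {y. (x, y) \<in> S} y :: real) \<partial>lborel)"
      by (intro Bochner_Integration.integral_cong) (auto simp: indicator_def)
    then show ?thesis by simp
  qed
  show "integrable lborel (\<lambda>x. measure lborel {y. (x, y) \<in> S})"
    using lborel_pair.integrable_fst'[OF int] by (simp add: eq)
  show "(\<integral>x. measure lborel {y. (x, y) \<in> S} \<partial>lborel) = measure lborel S"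
    using lborel_pair.integral_fst'[OF int] by (simp add: eq lborel_prod)
qed

text \<open>
  In the application \<open>\<delta>\<close> is the restriction to the horizontal line at height \<open>e\<close> of a function on
  the plane that vanishes on \<open>K\<close> and is \<open>M\<close>-Lipschitz along axis-parallel lines through points of
  \<open>K\<close>, and \<open>(x1, e)\<close> is a point of \<open>K\<close>.
  Above a point \<open>x\<close> with \<open>(x, y) \<in> K\<close> for some \<open>y\<close>, the vertical segment from \<open>(x, e)\<close> to the
  nearest such \<open>y\<close> avoids \<open>K\<close>, so its length is at most the measure of the part of the
  vertical line outside \<open>K\<close>.  If the vertical line misses \<open>K\<close> completely, all of \<open>{s..t}\<close> lies
  outside \<open>K\<close>, and the crude bound by the distance from \<open>x1\<close> is within the factor
  \<open>(b - a) / (t - s)\<close> of that.  Fubini's theorem turns the bound on sections into a bound by area.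
\<close>

lemma integral_edge_le_measure_gaps:
  fixes K :: "(real \<times> real) set"
  assumes K: "compact K" and "a \<le> b" "s < t" "0 \<le> M"
    and e: "e \<in> {s..t}" and x1: "x1 \<in> {a..b}"
    and vert: "\<And>x y. (x, y) \<in> K \<Longrightarrow> x \<in> {a..b} \<Longrightarrow> y \<in> {s..t} \<and> \<delta> x \<le> M * \<bar>y - e\<bar>"
    and hor: "\<And>x. x \<in> {a..b} \<Longrightarrow> \<delta> x \<le> M * \<bar>x - x1\<bar>"
    and \<delta>: "continuous_on {a..b} \<delta>"
    and Q: "cbox (a, s) (b, t) \<subseteq> Q" "compact Q"
  shows "integral {a..b} \<delta> \<le> M * (1 + (b - a) / (t - s)) * measure lborel (Q - K)"
proof -
  let ?C = "M * (1 + (b - a) / (t - s))"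
  define S where "S = cbox (a, s) (b, t) - K"
  define m where "m x = measure lborel {y. (x, y) \<in> S}" for x
  have S: "S \<in> sets borel" "emeasure lborel S < \<infinity>"
    using fmeasurable_compact_Diff[OF compact_cbox K, of "(a, s)" "(b, t)"]
    by (auto simp: S_def fmeasurable_def)
  note mm = lborel_measure_sections[OF S, folded m_def]
  have C: "0 \<le> ?C" "M \<le> ?C"
    using assms mult_left_mono[of 1 "1 + (b - a) / (t - s)" M] by auto
  have pt: "\<delta> x \<le> ?C * m x" if x: "x \<in> {a..b}" for x
  proof (cases "\<exists>y. (x, y) \<in> K")
    case False
    then have "{y. (x, y) \<in> S} = {s..t}"
      using x by (auto simp: S_def cbox_Pair_eq)
    then have m: "m x = t - s" using \<open>s < t\<close> by (simp add: m_def)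
    have "\<delta> x \<le> M * \<bar>x - x1\<bar>" using hor[OF x] .
    also have "\<dots> \<le> M * (b - a)" using x x1 \<open>0 \<le> M\<close> by (intro mult_left_mono) auto
    also have "\<dots> \<le> M * ((t - s) + (b - a))" using \<open>s < t\<close> \<open>0 \<le> M\<close> by (intro mult_left_mono) auto
    finally have "\<delta> x \<le> M * ((t - s) + (b - a))" .
    moreover have "(1 + (b - a) / (t - s)) * (t - s) = (t - s) + (b - a)"
      using \<open>s < t\<close> by (simp only: distrib_right) simp
    ultimately show ?thesis by (simp only: m mult.assoc)
  next
    case True
    have cl: "compact {y. (x, y) \<in> K}"
    proof -
      have "{y. (x, y) \<in> K} = snd ` (K \<inter> ({x} \<times> UNIV))" by force
      moreover have "compact (K \<inter> ({x} \<times> UNIV))"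
        by (intro compact_Int_closed K closed_Times) auto
      ultimately show ?thesis
        using compact_continuous_image[of _ snd] by (simp add: continuous_on_snd continuous_on_id)
    qed
    have "continuous_on {y. (x, y) \<in> K} (\<lambda>y. \<bar>y - e\<bar>)" by (intro continuous_intros)
    with continuous_attains_inf[OF cl _ this] True
    obtain y where y: "(x, y) \<in> K" and near: "\<And>y'. (x, y') \<in> K \<Longrightarrow> \<bar>y - e\<bar> \<le> \<bar>y' - e\<bar>"
      by auto
    have ys: "y \<in> {s..t}" and dy: "\<delta> x \<le> M * \<bar>y - e\<bar>" using vert[OF y x] by auto
    let ?J = "{min y e<..<max y e}"
    have sub: "?J \<subseteq> {y. (x, y) \<in> S}"
    proof
      fix v assume v: "v \<in> ?J"
      then have "\<bar>v - e\<bar> < \<bar>y - e\<bar>" by (auto simp: min_def max_def split: if_splits)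
      then have "(x, v) \<notin> K" using near by force
      moreover have "v \<in> {s..t}" using v ys e by (auto simp: min_def max_def split: if_splits)
      ultimately show "v \<in> {y. (x, y) \<in> S}" using x by (auto simp: S_def cbox_Pair_eq)
    qed
    have fm: "{y. (x, y) \<in> S} \<in> fmeasurable lborel"
    proof -
      have eq: "{y. (x, y) \<in> S} = {s..t} - {y. (x, y) \<in> K}"
        using x by (auto simp: S_def cbox_Pair_eq)
      have "{y. (x, y) \<in> S} \<in> sets borel" unfolding eq
        using cl by (intro sets.Diff borel_closed compact_imp_closed) auto
      moreover have "bounded {y. (x, y) \<in> S}" unfolding eq
        by (rule bounded_subset[of "{s..t}"]) auto
      ultimately show ?thesis by (auto intro!: fmeasurableI emeasure_bounded_finite)
    qed
    have "\<bar>y - e\<bar> = measure lborel ?J" by (auto simp: min_def max_def)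
    also have "\<dots> \<le> m x" unfolding m_def by (rule measure_mono_fmeasurable[OF sub _ fm]) auto
    finally have "M * \<bar>y - e\<bar> \<le> ?C * m x" using C \<open>0 \<le> M\<close>
      by (intro mult_mono) auto
    with dy show ?thesis by simp
  qed
  have int\<delta>: "set_integrable lborel {a..b} \<delta>"
    unfolding set_integrable_def by (intro borel_integrable_compact \<delta>) auto
  have "integral {a..b} \<delta> = (\<integral>x. indicator {a..b} x *\<^sub>R \<delta> x \<partial>lborel)"
    using set_borel_integral_eq_integral(2)[OF int\<delta>] by (simp add: set_lebesgue_integral_def)
  also have "\<dots> \<le> (\<integral>x. ?C * m x \<partial>lborel)"
  proof (rule integral_mono)
    show "integrable lborel (\<lambda>x. indicator {a..b} x *\<^sub>R \<delta> x)"
      using int\<delta> by (simp add: set_integrable_def)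
    show "integrable lborel (\<lambda>x. ?C * m x)" using mm(1) by simp
    show "indicator {a..b} x *\<^sub>R \<delta> x \<le> ?C * m x" for x
      using pt[of x] C by (auto simp: indicator_def m_def)
  qed
  also have "\<dots> = ?C * measure lborel S" using mm by simp
  also have "\<dots> \<le> ?C * measure lborel (Q - K)"
  proof (intro mult_left_mono C measure_mono_fmeasurable)
    show "S \<subseteq> Q - K" using Q by (auto simp: S_def)
    show "S \<in> sets lborel" using S by simp
    show "Q - K \<in> fmeasurable lborel"
      using K Q by (intro fmeasurable_compact_Diff)
  qed
  finally show ?thesis .
qed

section \<open>Boundary integrals and difference quotients\<close>

text \<open>
  This is the contour integral of \<open>f dz\<close> counterclockwise along the boundary of the rectangle
  with corners \<open>a + \<i> c\<close> and \<open>b + \<i> d\<close>.  Points of the plane are pairs of reals here, so that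
  Lebesgue measure on the plane is a product measure.
\<close>

definition rect_integral :: "(real \<times> real \<Rightarrow> complex) \<Rightarrow> real \<Rightarrow> real \<Rightarrow> real \<Rightarrow> real \<Rightarrow> complex" where
  "rect_integral f a b c d =
     integral {a..b} (\<lambda>x. f (x, c) - f (x, d)) + \<i> * integral {c..d} (\<lambda>y. f (b, y) - f (a, y))"

lemma integral_near_const:
  fixes \<gamma> :: "real \<Rightarrow> complex"
  assumes "\<And>x y. norm (\<gamma> x - \<gamma> y) \<le> L * \<bar>x - y\<bar>" "0 \<le> h" "0 \<le> L" "continuous_on UNIV \<gamma>"
  shows "norm (integral {c..c + h} \<gamma> - h *\<^sub>R \<gamma> c) \<le> L * h ^ 2"
proof -
  have int: "\<gamma> integrable_on {c..c+h}"
    by (rule integrable_continuous_real) (rule continuous_on_subset[OF assms(4)], auto)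
  have "integral {c..c + h} \<gamma> - h *\<^sub>R \<gamma> c = integral {c..c + h} (\<lambda>y. \<gamma> y - \<gamma> c)"
    using int \<open>0 \<le> h\<close> by (subst Henstock_Kurzweil_Integration.integral_diff) auto
  also have "norm \<dots> \<le> (L * h) * (c + h - c)"
  proof (rule integral_bound)
    show "continuous_on {c..c + h} (\<lambda>y. \<gamma> y - \<gamma> c)"
      by (intro continuous_intros continuous_on_subset[OF assms(4)]) auto
    fix y assume y: "y \<in> {c..c + h}"
    have "norm (\<gamma> y - \<gamma> c) \<le> L * \<bar>y - c\<bar>" by (rule assms)
    also have "\<dots> \<le> L * h" using y assms by (intro mult_left_mono) auto
    finally show "norm (\<gamma> y - \<gamma> c) \<le> L * h" .
  qed (use assms in auto)
  finally show ?thesis using assms by (simp add: power2_eq_square)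
qed

text \<open>
  After translation the integral telescopes to integrals of \<open>\<gamma>\<close> over two intervals of length \<open>h\<close>,
  starting at \<open>d\<close> and at \<open>c\<close>.
\<close>

lemma integral_difference_quotient:
  fixes \<gamma> :: "real \<Rightarrow> complex"
  assumes lip: "\<And>x y. norm (\<gamma> x - \<gamma> y) \<le> L * \<bar>x - y\<bar>" and "0 \<le> h" "0 \<le> L" "c \<le> d"
    and cont: "continuous_on UNIV \<gamma>"
  shows "norm (integral {c..d} (\<lambda>y. \<gamma> (y + h) - \<gamma> y) - h *\<^sub>R (\<gamma> d - \<gamma> c)) \<le> 2 * L * h ^ 2"
proof -
  have int: "\<gamma> integrable_on {x..y}" for x y
    by (rule integrable_continuous_real) (rule continuous_on_subset[OF cont], auto)
  have shift: "((\<lambda>y. \<gamma> (y + h)) has_integral integral {c+h..d+h} \<gamma>) {c..d}"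
    using has_integral_affinity'[of \<gamma> "integral {c+h..d+h} \<gamma>" "c+h" "d+h" 1 h] int
    by auto
  have "integral {c..d} (\<lambda>y. \<gamma> (y + h) - \<gamma> y) = integral {c+h..d+h} \<gamma> - integral {c..d} \<gamma>"
    using shift int by (subst Henstock_Kurzweil_Integration.integral_diff) (auto simp: has_integral_iff)
  also have "\<dots> = integral {d..d+h} \<gamma> - integral {c..c+h} \<gamma>"
    using Henstock_Kurzweil_Integration.integral_combine[of c "c+h" "d+h" \<gamma>]
      Henstock_Kurzweil_Integration.integral_combine[of c d "d+h" \<gamma>] int assms
    by (simp add: algebra_simps)
  finally have "integral {c..d} (\<lambda>y. \<gamma> (y + h) - \<gamma> y) - h *\<^sub>R (\<gamma> d - \<gamma> c) =
      (integral {d..d+h} \<gamma> - h *\<^sub>R \<gamma> d) - (integral {c..c+h} \<gamma> - h *\<^sub>R \<gamma> c)"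
    by (simp add: scaleR_diff_right)
  also have "norm \<dots> \<le> L * h ^ 2 + L * h ^ 2"
    by (intro order.trans[OF norm_triangle_ineq4] add_mono integral_near_const assms)
  finally show ?thesis by simp
qed

lemma lipschitz_continuous_on:
  fixes g :: "'a::metric_space \<Rightarrow> 'b::real_normed_vector"
  assumes "\<And>p q. norm (g p - g q) \<le> L * dist p q" and "0 \<le> L"
  shows "continuous_on S g"
proof -
  have "L-lipschitz_on S g" using assms by (intro lipschitz_onI) (auto simp: dist_norm)
  then show ?thesis by (rule lipschitz_on_continuous_on)
qed

lemma integral_vertical_difference_quotient:
  fixes g :: "real \<times> real \<Rightarrow> complex"
  assumes lip: "\<And>p q. norm (g p - g q) \<le> L * dist p q" and "0 \<le> h" "0 \<le> L" "a \<le> b" "c \<le> d"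
  shows "norm (integral (cbox (a, c) (b, d)) (\<lambda>p. g (p + (0, h)) - g p)
           - h *\<^sub>R integral {a..b} (\<lambda>x. g (x, d) - g (x, c))) \<le> 2 * L * h ^ 2 * (b - a)"
proof -
  have cont: "continuous_on S g" for S by (rule lipschitz_continuous_on[OF lip \<open>0 \<le> L\<close>])
  note gc = continuous_on_compose2[OF cont[of UNIV]]
  let ?I = "\<lambda>x. integral {c..d} (\<lambda>y. g (x, y + h) - g (x, y))"
  have cc: "continuous_on (cbox (a, c) (b, d)) (\<lambda>p. g (p + (0, h)) - g p)"
    by (intro continuous_intros gc) auto
  have eq: "integral (cbox (a, c) (b, d)) (\<lambda>p. g (p + (0, h)) - g p) = integral {a..b} ?I"
    using integral_prod_continuous[OF cc] by simp
  have contI: "continuous_on {a..b} ?I"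
  proof -
    have "continuous_on (cbox a b) (\<lambda>x. integral (cbox c d) (\<lambda>y. g (x, y + h) - g (x, y)))"
      by (intro integral_continuous_on_param) (auto intro!: continuous_intros gc simp: case_prod_beta)
    then show ?thesis by simp
  qed
  have contD: "continuous_on {a..b} (\<lambda>x. g (x, d) - g (x, c))"
    by (intro continuous_intros gc) auto
  have "integral {a..b} ?I - h *\<^sub>R integral {a..b} (\<lambda>x. g (x, d) - g (x, c)) =
     integral {a..b} (\<lambda>x. ?I x - h *\<^sub>R (g (x, d) - g (x, c)))"
    using contI contD
    by (subst Henstock_Kurzweil_Integration.integral_diff)
      (auto intro!: integrable_continuous_real continuous_intros simp: integral_cmul)
  also have "norm \<dots> \<le> 2 * L * h ^ 2 * (b - a)"
  proof (rule integral_bound)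
    show "continuous_on {a..b} (\<lambda>x. ?I x - h *\<^sub>R (g (x, d) - g (x, c)))"
      by (intro continuous_intros contI gc) auto
    show "norm (?I x - h *\<^sub>R (g (x, d) - g (x, c))) \<le> 2 * L * h ^ 2" for x
    proof (rule integral_difference_quotient)
      show "norm (g (x, y) - g (x, y')) \<le> L * \<bar>y - y'\<bar>" for y y'
        using lip[of "(x, y)" "(x, y')"] by (simp add: dist_prod_def dist_real_def)
      show "continuous_on UNIV (\<lambda>y. g (x, y))" by (intro gc continuous_intros) auto
    qed (use assms in auto)
  qed (use assms in auto)
  finally show ?thesis using eq \<open>a \<le> b\<close> by simp
qed

text \<open>
  The vertical case with the coordinates exchanged.
\<close>

lemma integral_horizontal_difference_quotient:
  fixes g :: "real \<times> real \<Rightarrow> complex"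
  assumes lip: "\<And>p q. norm (g p - g q) \<le> L * dist p q" and "0 \<le> h" "0 \<le> L" "a \<le> b" "c \<le> d"
  shows "norm (integral (cbox (a, c) (b, d)) (\<lambda>p. g (p + (h, 0)) - g p)
           - h *\<^sub>R integral {c..d} (\<lambda>y. g (b, y) - g (a, y))) \<le> 2 * L * h ^ 2 * (d - c)"
proof -
  have cont: "continuous_on S g" for S by (rule lipschitz_continuous_on[OF lip \<open>0 \<le> L\<close>])
  note gc = continuous_on_compose2[OF cont[of UNIV]]
  have "integral (cbox (a, c) (b, d)) (\<lambda>(x, y). g ((x, y) + (h, 0)) - g (x, y))
      = integral (cbox (c, a) (d, b)) (\<lambda>(x, y). g ((y, x) + (h, 0)) - g (y, x))"
    by (rule integral_swap_2dim) (auto intro!: continuous_intros gc simp: case_prod_beta)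
  then have sw: "integral (cbox (a, c) (b, d)) (\<lambda>p. g (p + (h, 0)) - g p)
      = integral (cbox (c, a) (d, b)) (\<lambda>p. g (prod.swap (p + (0, h))) - g (prod.swap p))"
    by (simp only: case_prod_unfold prod.swap_def plus_prod_def prod.collapse fst_conv snd_conv add_0_right)
  have "norm (g (prod.swap p) - g (prod.swap q)) \<le> L * dist p q" for p q
    using lip[of "prod.swap p" "prod.swap q"] by (simp add: dist_prod_def add.commute)
  from integral_vertical_difference_quotient[OF this \<open>0 \<le> h\<close> \<open>0 \<le> L\<close> \<open>c \<le> d\<close> \<open>a \<le> b\<close>]
  show ?thesis unfolding sw by simp
qed

lemma measure_collar_small:
  fixes K :: "'a::euclidean_space set"
  assumes K: "compact K" and "0 < e"
  obtains \<delta> where "0 < \<delta>" "measure lborel ({x + y | x y. x \<in> K \<and> y \<in> cball 0 \<delta>} - K) < e"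
proof -
  define B where "B n = {x + y | x y. x \<in> K \<and> y \<in> cball 0 (1 / real (Suc n))} - K" for n
  have fm: "B n \<in> fmeasurable lborel" for n
    unfolding B_def by (intro fmeasurable_compact_Diff compact_sums K compact_cball)
  have "(\<lambda>n. measure lborel (B n)) \<longlonglongrightarrow> measure lborel (\<Inter>n. B n)"
  proof (rule Lim_measure_decseq)
    show "range B \<subseteq> sets lborel" using fm by (auto simp: fmeasurable_def)
    show "decseq B"
      unfolding B_def
    proof (intro decseq_SucI Diff_mono Collect_mono order.refl ex_mono impI allI)
      fix n :: nat and p x y :: 'a
      assume *: "p = x + y \<and> x \<in> K \<and> y \<in> cball 0 (1 / real (Suc (Suc n)))"
      have "1 / real (Suc (Suc n)) \<le> 1 / real (Suc n)" by (auto simp: field_simps)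
      with * show "p = x + y \<and> x \<in> K \<and> y \<in> cball 0 (1 / real (Suc n))" by auto
    qed
    show "emeasure lborel (B n) \<noteq> \<infinity>" for n using fm[of n] by (auto simp: fmeasurable_def)
  qed
  moreover have "(\<Inter>n. B n) = {}"
  proof -
    have False if p: "\<And>n. p \<in> B n" for p
    proof -
      have "p \<in> closure K"
        unfolding closure_approachable
      proof (intro allI impI)
        fix r :: real assume "0 < r"
        then obtain n where n: "1 / real (Suc n) < r" using nat_approx_posE by blast
        from p[of n] obtain x y where "p = x + y" "x \<in> K" "norm y \<le> 1 / real (Suc n)"
          by (auto simp: B_def)
        then show "\<exists>y\<in>K. dist y p < r" using n by (intro bexI[of _ x]) (auto simp: dist_norm)
      qed
      then have "p \<in> K" using K by (simp add: compact_imp_closed)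
      with p[of 0] show False by (auto simp: B_def)
    qed
    then show ?thesis by blast
  qed
  ultimately have "(\<lambda>n. measure lborel (B n)) \<longlonglongrightarrow> 0" by simp
  then have "eventually (\<lambda>n. measure lborel (B n) < e) sequentially"
    using \<open>0 < e\<close> by (simp add: order_tendstoD)
  then obtain n where "measure lborel (B n) < e" by (auto simp: eventually_sequentially)
  then show thesis by (intro that[of "1 / real (Suc n)"]) (auto simp: B_def)
qed

text \<open>
  A compact set is almost invariant under small translations: the translate of the points that
  leave \<open>K\<close> lies in a thin collar of \<open>K\<close>.  This replaces any appeal to density points of \<open>K\<close>
  in the estimate of the difference quotients.
\<close>

lemma measure_shift_out_small:
  fixes K :: "'a::euclidean_space set"
  assumes K: "compact K" and w: "(w :: nat \<Rightarrow> 'a) \<longlonglongrightarrow> 0"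
  shows "(\<lambda>n. measure lborel {p \<in> K. p + w n \<notin> K}) \<longlonglongrightarrow> 0"
proof (rule LIMSEQ_I)
  fix e :: real assume "0 < e"
  obtain \<delta> where \<delta>: "0 < \<delta>" "measure lborel ({x + y | x y. x \<in> K \<and> y \<in> cball 0 \<delta>} - K) < e"
    using measure_collar_small[OF K \<open>0 < e\<close>] .
  obtain n0 where n0: "\<And>n. n \<ge> n0 \<Longrightarrow> norm (w n) < \<delta>"
    using LIMSEQ_D[OF w \<open>0 < \<delta>\<close>] by auto
  have "measure lborel {p \<in> K. p + w n \<notin> K} < e" if "n \<ge> n0" for n
  proof -
    define B where "B = (+) (w n) ` K - K"
    have cK: "compact ((+) (w n) ` K)" by (intro compact_translation K)
    then have B: "B \<in> fmeasurable lborel" unfolding B_def by (intro fmeasurable_compact_Diff K)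
    have "measure lborel B = measure (distr lborel borel ((+) (w n))) B"
      by (simp add: lborel_distr_plus)
    also have "\<dots> = measure lborel ((+) (w n) -` B)"
      using B by (subst measure_distr) (auto simp: fmeasurable_def)
    also have "(+) (w n) -` B = {p \<in> K. p + w n \<notin> K}"
      by (auto simp: B_def add.commute)
    finally have "measure lborel {p \<in> K. p + w n \<notin> K} = measure lborel B" by simp
    also have "\<dots> \<le> measure lborel ({x + y | x y. x \<in> K \<and> y \<in> cball 0 \<delta>} - K)"
    proof (rule measure_mono_fmeasurable)
      show "B \<subseteq> {x + y |x y. x \<in> K \<and> y \<in> cball 0 \<delta>} - K"
        using n0[OF that] by (force simp: B_def add.commute)
      show "{x + y |x y. x \<in> K \<and> y \<in> cball 0 \<delta>} - K \<in> fmeasurable lborel"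
        by (intro fmeasurable_compact_Diff compact_sums K compact_cball)
    qed (use B in \<open>auto simp: fmeasurable_def\<close>)
    finally show ?thesis using \<delta> by simp
  qed
  then show "\<exists>n0. \<forall>n\<ge>n0. norm (measure lborel {p \<in> K. p + w n \<notin> K} - 0) < e" by auto
qed

text \<open>
  The difference quotient, with step \<open>1 / (n + 1)\<close>, of twice the d-bar derivative.
\<close>

definition dbar_quotient :: "(real \<times> real \<Rightarrow> complex) \<Rightarrow> nat \<Rightarrow> real \<times> real \<Rightarrow> complex" where
  "dbar_quotient f n p =
     real (Suc n) *\<^sub>R (f (p + (1 / real (Suc n), 0)) - f p) +
     \<i> * (real (Suc n) *\<^sub>R (f (p + (0, 1 / real (Suc n))) - f p))"

lemma norm_dbar_quotient_le:
  assumes lip: "\<And>p q. norm (g p - g q) \<le> L * dist p q"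
  shows "norm (dbar_quotient g n p) \<le> 2 * L"
proof -
  have "norm (real (Suc n) *\<^sub>R (g (p + w) - g p)) \<le> L" if "norm w = 1 / real (Suc n)" for w
  proof -
    have "norm (g (p + w) - g p) \<le> L * (1 / real (Suc n))"
      using lip[of "p + w" p] that by (simp add: dist_norm)
    then show ?thesis unfolding norm_scaleR by (simp add: field_simps del: of_nat_Suc)
  qed
  from this[of "(1 / real (Suc n), 0)"] this[of "(0, 1 / real (Suc n))"]
  show ?thesis
    unfolding dbar_quotient_def
    by (intro order.trans[OF norm_triangle_ineq]) (simp add: norm_mult norm_Pair del: of_nat_Suc)
qed

text \<open>
  For Lipschitz \<open>g\<close> this is a form of Green's theorem that does not mention derivatives of \<open>g\<close>.
\<close>

lemma integral_dbar_quotient_tendsto: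
  assumes lip: "\<And>p q. norm (g p - g q) \<le> L * dist p q" and "0 \<le> L" "a \<le> b" "c \<le> d"
  shows "(\<lambda>n. integral (cbox (a, c) (b, d)) (dbar_quotient g n)) \<longlonglongrightarrow> - \<i> * rect_integral g a b c d"
proof (rule Lim_null[THEN iffD2, OF Lim_null_comparison])
  have cont: "continuous_on S g" for S by (rule lipschitz_continuous_on[OF lip \<open>0 \<le> L\<close>])
  note gc = continuous_on_compose2[OF cont[of UNIV]]
  let ?R = "cbox (a, c) (b, d)"
  let ?X = "integral {c..d} (\<lambda>y. g (b, y) - g (a, y))" and ?Y = "integral {a..b} (\<lambda>x. g (x, d) - g (x, c))"
  have rect: "- \<i> * rect_integral g a b c d = ?X + \<i> * ?Y"
  proof -
    have "integral {a..b} (\<lambda>x. g (x, c) - g (x, d)) = integral {a..b} (\<lambda>x. - (g (x, d) - g (x, c)))"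
      by simp
    also have "\<dots> = - ?Y" by (rule integral_neg)
    finally show ?thesis by (simp add: rect_integral_def algebra_simps)
  qed
  let ?B = "\<lambda>n. (2 * L * (b - a) + 2 * L * (d - c)) * (1 / real (Suc n))"
  show "\<forall>\<^sub>F n in sequentially.
    norm (integral ?R (dbar_quotient g n) - - \<i> * rect_integral g a b c d) \<le> ?B n"
  proof (rule always_eventually, rule allI)
    fix n
    define h where "h = 1 / real (Suc n)"
    have h: "0 < h" and hn: "real (Suc n) = 1 / h" by (simp_all add: h_def)
    let ?H = "\<lambda>p. g (p + (h, 0)) - g p" and ?V = "\<lambda>p. g (p + (0, h)) - g p"
    have intH: "?H integrable_on ?R" and intV: "?V integrable_on ?R"
      by (intro integrable_continuous continuous_intros gc; auto)+
    have "integral ?R (dbar_quotient g n) = integral ?R (\<lambda>p. (1/h) *\<^sub>R ?H p + \<i> * ((1/h) *\<^sub>R ?V p))"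
      unfolding dbar_quotient_def[abs_def] h_def[symmetric] unfolding hn ..
    also have "\<dots> = (1/h) *\<^sub>R integral ?R ?H + \<i> * ((1/h) *\<^sub>R integral ?R ?V)"
      using intH intV
      by (subst Henstock_Kurzweil_Integration.integral_add)
         (auto intro!: integrable_cmul integrable_on_mult_right simp del: scaleR_conv_of_real
           simp: integral_cmul integral_mult_right)
    finally have "integral ?R (dbar_quotient g n) - - \<i> * rect_integral g a b c d =
        (1/h) *\<^sub>R (integral ?R ?H - h *\<^sub>R ?X) + \<i> * ((1/h) *\<^sub>R (integral ?R ?V - h *\<^sub>R ?Y))"
      unfolding rect using h by (simp add: algebra_simps)
    also have "norm \<dots> \<le> (1/h) * (2 * L * h ^ 2 * (d - c)) + (1/h) * (2 * L * h ^ 2 * (b - a))"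
      using integral_horizontal_difference_quotient[OF lip _ \<open>0 \<le> L\<close> \<open>a \<le> b\<close> \<open>c \<le> d\<close>, of h]
        integral_vertical_difference_quotient[OF lip _ \<open>0 \<le> L\<close> \<open>a \<le> b\<close> \<open>c \<le> d\<close>, of h] h
      unfolding norm_scaleR
      by (intro order.trans[OF norm_triangle_ineq] add_mono)
         (auto simp: norm_mult abs_of_pos intro!: divide_right_mono)
    also have "\<dots> = ?B n" using h unfolding h_def[symmetric] by (simp add: power2_eq_square algebra_simps)
    finally show "norm (integral ?R (dbar_quotient g n) - - \<i> * rect_integral g a b c d) \<le> ?B n" .
  qed
  show "?B \<longlonglongrightarrow> 0"
    by (rule tendsto_mult_right_zero) (use LIMSEQ_inverse_real_of_nat in \<open>simp add: inverse_eq_divide\<close>)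
qed

text \<open>
  The difference quotients of \<open>g\<close> are bounded by \<open>2 * L\<close>, which accounts for the part of the
  rectangle outside \<open>K\<close>.  At a point of \<open>K\<close> whose two shifts again lie in \<open>K\<close>, the
  quotients of \<open>g\<close> and \<open>f\<close> coincide, and those of \<open>f\<close> tend to zero almost everywhere; the
  remaining points of \<open>K\<close> form a set of measure tending to zero.
\<close>

lemma norm_rect_integral_lipschitz_le:
  fixes g f :: "real \<times> real \<Rightarrow> complex"
  assumes K: "compact K" "K \<subseteq> cbox (a, c) (b, d)" and "a \<le> b" "c \<le> d"
    and lip: "\<And>p q. norm (g p - g q) \<le> L * dist p q" and "0 \<le> L"
    and eq: "\<And>p. p \<in> K \<Longrightarrow> g p = f p"
    and ae: "AE p in lborel. p \<in> K \<longrightarrow> (\<lambda>n. dbar_quotient f n p) \<longlonglongrightarrow> 0"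
  shows "norm (rect_integral g a b c d) \<le> 2 * L * measure lborel (cbox (a, c) (b, d) - K)"
proof -
  let ?R = "cbox (a, c) (b, d)"
  let ?q = "dbar_quotient g"
  define h where "h n = 1 / real (Suc n)" for n
  define X where "X n = {p \<in> K. p + (h n, 0) \<notin> K}" for n
  define Y where "Y n = {p \<in> K. p + (0, h n) \<notin> K}" for n
  define Z where "Z n = {p \<in> K. p + (h n, 0) \<in> K \<and> p + (0, h n) \<in> K}" for n
  have cont: "continuous_on S g" for S by (rule lipschitz_continuous_on[OF lip \<open>0 \<le> L\<close>])
  note gc = continuous_on_compose2[OF cont[of UNIV]]
  have contq: "continuous_on S (?q n)" for S n
    unfolding dbar_quotient_def by (intro continuous_intros gc) auto
  have q2L: "norm (?q n p) \<le> 2 * L" for n p by (rule norm_dbar_quotient_le[OF lip])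
  have mq[measurable]: "?q n \<in> borel_measurable borel" for n
    using contq[of UNIV] by (rule borel_measurable_continuous_onI)
  have Kb[measurable]: "K \<in> sets borel" using K by (simp add: borel_closed compact_imp_closed)
  have Rb[measurable]: "?R \<in> sets borel" by simp
  have shb: "{p. p + w \<in> K} \<in> sets borel" for w
  proof -
    have "{p. p + w \<in> K} = (\<lambda>p. p + w) -` K" by auto
    moreover have "closed ((\<lambda>p. p + w) -` K)"
      using K(1) by (intro closed_vimage compact_imp_closed continuous_intros)
    ultimately show ?thesis by (simp add: borel_closed)
  qed
  have XYZ[measurable]: "X n \<in> sets borel" "Y n \<in> sets borel" "Z n \<in> sets borel" for n
  proof -
    have "X n = K - {p. p + (h n, 0) \<in> K}" "Y n = K - {p. p + (0, h n) \<in> K}"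
      "Z n = K \<inter> {p. p + (h n, 0) \<in> K} \<inter> {p. p + (0, h n) \<in> K}"
      by (auto simp: X_def Y_def Z_def)
    then show "X n \<in> sets borel" "Y n \<in> sets borel" "Z n \<in> sets borel"
      using Kb shb by auto
  qed
  have fin: "emeasure lborel S < \<infinity>" if "S \<subseteq> ?R" for S
    using that by (intro emeasure_bounded_finite) (rule bounded_subset[OF bounded_cbox])
  have sub: "X n \<subseteq> ?R" "Y n \<subseteq> ?R" "Z n \<subseteq> ?R" "?R - K \<subseteq> ?R" for n
    using K by (auto simp: X_def Y_def Z_def)
  \<comment> \<open>The points of \<open>K\<close> split into those that a shift moves out of \<open>K\<close>, covered by \<open>X n\<close> and \<open>Y n\<close>, and \<open>Z n\<close>.\<close>
  have intind: "integrable lborel (\<lambda>p. indicator S p :: real)" if "S \<subseteq> ?R" "S \<in> sets borel" for S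
    using fin[OF that(1)] that(2) by simp
  have h0: "(\<lambda>n. h n) \<longlonglongrightarrow> 0"
    unfolding h_def using LIMSEQ_inverse_real_of_nat by (simp add: inverse_eq_divide)
  have hX: "(\<lambda>n. (h n, 0::real)) \<longlonglongrightarrow> 0" and hY: "(\<lambda>n. (0::real, h n)) \<longlonglongrightarrow> 0"
    using tendsto_Pair[OF h0 tendsto_const[of 0]] tendsto_Pair[OF tendsto_const[of 0] h0]
    by (simp_all add: zero_prod_def)
  have mX: "(\<lambda>n. measure lborel (X n)) \<longlonglongrightarrow> 0"
    unfolding X_def by (rule measure_shift_out_small[OF K(1) hX])
  have mY: "(\<lambda>n. measure lborel (Y n)) \<longlonglongrightarrow> 0"
    unfolding Y_def by (rule measure_shift_out_small[OF K(1) hY])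
  have intZ: "integrable lborel (\<lambda>p. indicator (Z n) p * norm (?q n p))" for n
  proof (rule Bochner_Integration.integrable_bound)
    show "integrable lborel (\<lambda>p. (2 * L) * indicator (Z n) p)" using intind[OF sub(3)] XYZ by simp
    show "AE p in lborel. norm (indicator (Z n) p * norm (?q n p)) \<le> norm ((2 * L) * indicator (Z n) p)"
      using q2L \<open>0 \<le> L\<close> by (auto simp: indicator_def)
  qed measurable
  have limZ: "(\<lambda>n. \<integral>p. indicator (Z n) p * norm (?q n p) \<partial>lborel) \<longlonglongrightarrow> (\<integral>p. 0 \<partial>(lborel :: (real \<times> real) measure))"
  proof (rule integral_dominated_convergence)
    show "integrable lborel (\<lambda>p. (2 * L) * indicator K p)"
      using intind[of K] K Kb by simp
    show "AE p in lborel. (\<lambda>n. indicator (Z n) p * norm (?q n p)) \<longlonglongrightarrow> 0"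
      using ae
    proof eventually_elim
      case (elim p)
      show ?case
      proof (cases "p \<in> K")
        case False
        then show ?thesis by (simp add: Z_def)
      next
        case True
        have "(\<lambda>n. norm (dbar_quotient f n p)) \<longlonglongrightarrow> 0"
          using elim True by (simp add: tendsto_norm_zero)
        then show ?thesis
        proof (rule Lim_null_comparison[rotated], intro always_eventually allI)
          show "norm (indicator (Z n) p * norm (?q n p)) \<le> norm (dbar_quotient f n p)" for n
            using eq[of p] eq[of "p + (h n, 0)"] eq[of "p + (0, h n)"]
            by (auto simp: Z_def indicator_def dbar_quotient_def h_def)
        qed
      qed
    qed
    show "AE p in lborel. norm (indicator (Z n) p * norm (?q n p)) \<le> (2 * L) * indicator K p" for n
      using q2L \<open>0 \<le> L\<close> by (auto simp: indicator_def Z_def)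
  qed measurable
  have bound: "norm (integral ?R (?q n)) \<le> 2 * L * measure lborel (?R - K)
      + 2 * L * (measure lborel (X n) + measure lborel (Y n))
      + (\<integral>p. indicator (Z n) p * norm (?q n p) \<partial>lborel)" for n
  proof -
    have si: "set_integrable lborel ?R (?q n)"
      unfolding set_integrable_def by (intro borel_integrable_compact contq compact_cbox)
    have "norm (integral ?R (?q n)) = norm (\<integral>p. indicator ?R p *\<^sub>R ?q n p \<partial>lborel)"
      using set_borel_integral_eq_integral(2)[OF si] by (simp add: set_lebesgue_integral_def)
    also have "\<dots> \<le> (\<integral>p. 2 * L * indicator (?R - K) p + 2 * L * (indicator (X n) p + indicator (Y n) p)
        + indicator (Z n) p * norm (?q n p) \<partial>lborel)"
    proof (rule Bochner_Integration.integral_norm_bound_integral)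
      show "integrable lborel (\<lambda>p. indicator ?R p *\<^sub>R ?q n p)"
        using si by (simp add: set_integrable_def)
      show "integrable lborel (\<lambda>p. 2 * L * indicator (?R - K) p + 2 * L * (indicator (X n) p + indicator (Y n) p)
        + indicator (Z n) p * norm (?q n p))"
        using sub XYZ Kb Rb by (intro Bochner_Integration.integrable_add integrable_mult_right intind intZ) auto
      show "norm (indicator ?R p *\<^sub>R ?q n p) \<le> 2 * L * indicator (?R - K) p + 2 * L * (indicator (X n) p + indicator (Y n) p)
        + indicator (Z n) p * norm (?q n p)" for p
        using q2L[of n p] K \<open>0 \<le> L\<close> by (auto simp: indicator_def X_def Y_def Z_def)
    qed
    also have "\<dots> = 2 * L * measure lborel (?R - K) + 2 * L * (measure lborel (X n) + measure lborel (Y n))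
      + (\<integral>p. indicator (Z n) p * norm (?q n p) \<partial>lborel)"
      using sub XYZ Kb Rb
      by (subst Bochner_Integration.integral_add Bochner_Integration.integral_mult_right_zero;
          (intro Bochner_Integration.integrable_add integrable_mult_right intind intZ)?; simp?)+
    finally show ?thesis .
  qed
  have lim: "(\<lambda>n. norm (integral ?R (?q n))) \<longlonglongrightarrow> norm (- \<i> * rect_integral g a b c d)"
    by (intro tendsto_norm integral_dbar_quotient_tendsto[OF lip] assms)
  have "norm (- \<i> * rect_integral g a b c d) \<le> 2 * L * measure lborel (?R - K) + 2 * L * (0 + 0) + 0"
  proof (rule LIMSEQ_le[OF lim])
    show "(\<lambda>n. 2 * L * measure lborel (?R - K)
      + 2 * L * (measure lborel (X n) + measure lborel (Y n))
      + (\<integral>p. indicator (Z n) p * norm (?q n p) \<partial>lborel)) \<longlonglongrightarrow> 2 * L * measure lborel (?R - K) + 2 * L * (0 + 0) + 0"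
      by (intro tendsto_intros mX mY) (use limZ in simp)
  qed (use bound in blast)
  then show ?thesis by (simp add: norm_mult)
qed

section \<open>Menchoff's estimate\<close>

lemma measure_lborel_swap:
  fixes S :: "(real \<times> real) set"
  assumes "S \<in> sets borel"
  shows "measure lborel (prod.swap ` S) = measure lborel S"
proof -
  have S: "S \<in> sets (lborel \<Otimes>\<^sub>M lborel)" using assms unfolding lborel_prod by simp
  have "measure lborel S = measure (distr (lborel \<Otimes>\<^sub>M lborel) (lborel \<Otimes>\<^sub>M lborel) (\<lambda>(x, y). (y, x))) S"
    using lborel_pair.distr_pair_swap[where ?'a = real and ?'b = real] by (simp add: lborel_prod)
  also have "\<dots> = measure (lborel \<Otimes>\<^sub>M lborel) ((\<lambda>(x, y). (y, x)) -` S \<inter> space (lborel \<Otimes>\<^sub>M lborel))"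
    by (intro measure_distr measurable_pair_swap' S)
  also have "(\<lambda>(x, y). (y, x)) -` S \<inter> space (lborel \<Otimes>\<^sub>M lborel) = prod.swap ` S"
    by (force simp: space_pair_measure)
  finally show ?thesis by (simp add: lborel_prod)
qed

text \<open>
  The rectangle \<open>{a..b} \<times> {c..d}\<close> is the smallest one containing \<open>K\<close>: each of its edges carries a
  point of \<open>K\<close>, which is what \<open>integral_edge_le_measure_gaps\<close> needs.  The measure on the right is
  taken over the larger rectangle because only there a vertical line that misses \<open>K\<close> is long
  enough compared with the width.  The constant adds up as follows: a Lipschitz extension \<open>g\<close> with
  constant \<open>4 * N\<close> contributes \<open>8 * N\<close>, and \<open>f - g\<close>, with axis constant \<open>5 * N\<close>, contributes
  \<open>5 * N\<close> times one plus an aspect ratio for each of the four edges.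
\<close>

lemma norm_rect_integral_le_measure_outside:
  fixes f :: "real \<times> real \<Rightarrow> complex"
  assumes K: "compact K" "K \<subseteq> cbox (a, c) (b, d)"
    and edges: "(xc, c) \<in> K" "(xd, d) \<in> K" "(a, ya) \<in> K" "(b, yb) \<in> K"
    and ord: "p \<le> a" "a \<le> b" "b \<le> q" "s \<le> c" "c \<le> d" "d \<le> t" "p < q" "s < t"
    and cont: "continuous_on (cbox (a, c) (b, d)) f"
    and N: "0 \<le> N"
    and hor: "\<And>x y x'. (x, y) \<in> K \<Longrightarrow> x' \<in> {a..b} \<Longrightarrow> norm (f (x', y) - f (x, y)) \<le> N * \<bar>x' - x\<bar>"
    and ver: "\<And>x y y'. (x, y) \<in> K \<Longrightarrow> y' \<in> {c..d} \<Longrightarrow> norm (f (x, y') - f (x, y)) \<le> N * \<bar>y' - y\<bar>"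
    and ae: "AE p in lborel. p \<in> K \<longrightarrow> (\<lambda>n. dbar_quotient f n p) \<longlonglongrightarrow> 0"
  shows "norm (rect_integral f a b c d) \<le>
    N * (28 + 10 * ((q - p) / (t - s) + (t - s) / (q - p))) * measure lborel (cbox (p, s) (q, t) - K)"
proof -
  let ?Q = "cbox (p, s) (q, t)" and ?R = "cbox (a, c) (b, d)"
  have Kab: "x \<in> {a..b}" "y \<in> {c..d}" if "(x, y) \<in> K" for x y
    using that K by (auto simp: cbox_Pair_eq)
  \<comment> \<open>Two points of \<open>K\<close> are compared via the corner \<open>(x, y')\<close>, which need not lie in \<open>K\<close>.\<close>
  have lipK: "norm (f u - f v) \<le> 2 * N * dist u v" if "u \<in> K" "v \<in> K" for u v
  proof -
    obtain x y x' y' where uv: "u = (x, y)" "v = (x', y')" by (metis surj_pair)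
    have "norm (f u - f v) \<le> norm (f (x, y') - f (x, y)) + norm (f (x, y') - f (x', y'))"
      unfolding uv by (metis norm_minus_commute norm_triangle_sub diff_add_cancel add.commute norm_diff_triangle_ineq
        diff_diff_eq2 norm_diff_triangle_le order_refl)
    also have "\<dots> \<le> N * \<bar>y' - y\<bar> + N * \<bar>x - x'\<bar>"
      using that unfolding uv by (intro add_mono ver hor Kab)
    also have "\<dots> \<le> N * dist u v + N * dist u v"
      using N dist_fst_le[of u v] dist_snd_le[of u v] unfolding uv
      by (intro add_mono mult_left_mono) (auto simp: dist_real_def abs_minus_commute)
    finally show ?thesis by simp
  qed
  obtain g where g: "\<And>u v. norm (g u - g v) \<le> 4 * N * dist u v" "\<And>u. u \<in> K \<Longrightarrow> g u = f u"
  proof -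
    have "K \<noteq> {}" "0 \<le> 2 * N" using edges N by auto
    from lipschitz_extension_complex[OF this(1) lipK this(2)] show thesis
      using that by (auto simp: mult.assoc)
  qed
  have contg: "continuous_on S g" for S
    using lipschitz_continuous_on[OF g(1)] N by simp
  define \<delta> where "\<delta> u = norm (f u - g u)" for u
  have cont\<delta>: "continuous_on ?R \<delta>"
    unfolding \<delta>_def by (intro continuous_intros cont contg)
  have dh: "\<delta> (x', y) \<le> 5 * N * \<bar>x' - x\<bar>" if "(x, y) \<in> K" "x' \<in> {a..b}" for x y x'
  proof -
    have "\<delta> (x', y) = norm ((f (x', y) - f (x, y)) - (g (x', y) - g (x, y)))"
      using g(2)[OF that(1)] by (simp add: \<delta>_def)
    also have "\<dots> \<le> N * \<bar>x' - x\<bar> + 4 * N * dist (x', y) (x, y)"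
      by (intro order.trans[OF norm_triangle_ineq4] add_mono hor that g)
    finally show ?thesis by (simp add: dist_Pair_Pair dist_real_def)
  qed
  have dv: "\<delta> (x, y') \<le> 5 * N * \<bar>y' - y\<bar>" if "(x, y) \<in> K" "y' \<in> {c..d}" for x y y'
  proof -
    have "\<delta> (x, y') = norm ((f (x, y') - f (x, y)) - (g (x, y') - g (x, y)))"
      using g(2)[OF that(1)] by (simp add: \<delta>_def)
    also have "\<dots> \<le> N * \<bar>y' - y\<bar> + 4 * N * dist (x, y') (x, y)"
      by (intro order.trans[OF norm_triangle_ineq4] add_mono ver that g)
    finally show ?thesis by (simp add: dist_Pair_Pair dist_real_def)
  qed
  let ?m = "measure lborel (?Q - K)"
  let ?rx = "(q - p) / (t - s)" and ?ry = "(t - s) / (q - p)"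
  have hedge: "integral {a..b} (\<lambda>x. \<delta> (x, e)) \<le> 5 * N * (1 + ?rx) * ?m" if e: "e \<in> {c..d}" "(x1, e) \<in> K" for e x1
  proof -
    have "integral {a..b} (\<lambda>x. \<delta> (x, e)) \<le> 5 * N * (1 + (b - a) / (t - s)) * ?m"
    proof (rule integral_edge_le_measure_gaps[OF K(1), where e = e and ?x1.0 = x1])
      show "continuous_on {a..b} (\<lambda>x. \<delta> (x, e))"
        by (rule continuous_on_compose2[OF cont\<delta>]) (use e in \<open>auto intro!: continuous_intros simp: cbox_Pair_eq\<close>)
      show "y \<in> {s..t} \<and> \<delta> (x, e) \<le> 5 * N * \<bar>y - e\<bar>" if "(x, y) \<in> K" for x y
        using dv[OF that e(1)] Kab[OF that] ord by (auto simp: abs_minus_commute)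
      show "e \<in> {s..t}" "x1 \<in> {a..b}" using e(1) ord Kab[OF e(2)] by auto
      show "cbox (a, s) (b, t) \<subseteq> ?Q" using ord by (auto simp: cbox_Pair_eq)
    qed (use ord N e dh in \<open>auto intro: compact_cbox\<close>)
    also have "\<dots> \<le> 5 * N * (1 + ?rx) * ?m"
      using ord N by (intro mult_right_mono mult_left_mono add_left_mono divide_right_mono) auto
    finally show ?thesis .
  qed
  have vedge: "integral {c..d} (\<lambda>y. \<delta> (e, y)) \<le> 5 * N * (1 + ?ry) * ?m" if e: "e \<in> {a..b}" "(e, y1) \<in> K" for e y1
  proof -
    have "integral {c..d} (\<lambda>y. \<delta> (e, y)) \<le> 5 * N * (1 + (d - c) / (q - p)) *
        measure lborel (prod.swap ` ?Q - prod.swap ` K)"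
    proof (rule integral_edge_le_measure_gaps[where e = e and ?x1.0 = y1])
      show "compact (prod.swap ` K)" "compact (prod.swap ` ?Q)"
        using K by (auto intro!: compact_continuous_image continuous_intros simp: prod.swap_def)
      show "continuous_on {c..d} (\<lambda>y. \<delta> (e, y))"
        by (rule continuous_on_compose2[OF cont\<delta>]) (use e in \<open>auto intro!: continuous_intros simp: cbox_Pair_eq\<close>)
      show "x \<in> {p..q} \<and> \<delta> (e, y) \<le> 5 * N * \<bar>x - e\<bar>" if "(y, x) \<in> prod.swap ` K" for x y
      proof -
        from that have k: "(x, y) \<in> K" by auto
        from dh[OF k e(1)] Kab[OF k] ord show ?thesis by (auto simp: abs_minus_commute)
      qed
      show "e \<in> {p..q}" "y1 \<in> {c..d}" using e(1) ord Kab[OF e(2)] by auto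
      show "cbox (c, p) (d, q) \<subseteq> prod.swap ` ?Q" using ord by (force simp: cbox_Pair_eq)
    qed (use ord N e dv in auto)
    also have "prod.swap ` ?Q - prod.swap ` K = prod.swap ` (?Q - K)" by auto
    also have "measure lborel \<dots> = ?m"
      using K by (intro measure_lborel_swap) (simp add: borel_closed compact_imp_closed sets.Diff)
    also have "5 * N * (1 + (d - c) / (q - p)) * ?m \<le> 5 * N * (1 + ?ry) * ?m"
      using ord N by (intro mult_right_mono mult_left_mono add_left_mono divide_right_mono) auto
    finally show ?thesis .
  qed
  have cR: "continuous_on {a..b} (\<lambda>x. \<phi> (x, e))" if "continuous_on ?R \<phi>" "e \<in> {c..d}" for \<phi> :: "real \<times> real \<Rightarrow> 'z::topological_space" and e
    by (rule continuous_on_compose2[OF that(1)]) (use that in \<open>auto intro!: continuous_intros simp: cbox_Pair_eq\<close>)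
  have cR': "continuous_on {c..d} (\<lambda>y. \<phi> (e, y))" if "continuous_on ?R \<phi>" "e \<in> {a..b}" for \<phi> :: "real \<times> real \<Rightarrow> 'z::topological_space" and e
    by (rule continuous_on_compose2[OF that(1)]) (use that in \<open>auto intro!: continuous_intros simp: cbox_Pair_eq\<close>)
  have ih: "(\<lambda>x. \<phi> (x, e)) integrable_on {a..b}" if "continuous_on ?R \<phi>" "e \<in> {c..d}" for \<phi> :: "real \<times> real \<Rightarrow> 'z::banach" and e
    by (intro integrable_continuous_real cR that)
  have iv: "(\<lambda>y. \<phi> (e, y)) integrable_on {c..d}" if "continuous_on ?R \<phi>" "e \<in> {a..b}" for \<phi> :: "real \<times> real \<Rightarrow> 'z::banach" and e
    by (intro integrable_continuous_real cR' that)
  have mem: "a \<in> {a..b}" "b \<in> {a..b}" "c \<in> {c..d}" "d \<in> {c..d}" using ord by auto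
  let ?\<phi> = "\<lambda>u. f u - g u"
  have c\<phi>: "continuous_on ?R ?\<phi>" by (intro continuous_intros cont contg)
  have expand: "rect_integral \<psi> a b c d = (integral {a..b} (\<lambda>x. \<psi> (x, c)) - integral {a..b} (\<lambda>x. \<psi> (x, d)))
       + \<i> * (integral {c..d} (\<lambda>y. \<psi> (b, y)) - integral {c..d} (\<lambda>y. \<psi> (a, y)))"
    if "continuous_on ?R \<psi>" for \<psi>
    unfolding rect_integral_def
    by (intro arg_cong2[where f = "(+)"] arg_cong[where f = "(*) \<i>"] Henstock_Kurzweil_Integration.integral_diff
        ih[OF that] iv[OF that] mem)
  have dh': "integral {a..b} (\<lambda>x. ?\<phi> (x, e)) = integral {a..b} (\<lambda>x. f (x, e)) - integral {a..b} (\<lambda>x. g (x, e))"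
    if "e \<in> {c..d}" for e
    by (intro Henstock_Kurzweil_Integration.integral_diff ih[OF cont that] ih[OF contg that])
  have dv': "integral {c..d} (\<lambda>y. ?\<phi> (e, y)) = integral {c..d} (\<lambda>y. f (e, y)) - integral {c..d} (\<lambda>y. g (e, y))"
    if "e \<in> {a..b}" for e
    by (intro Henstock_Kurzweil_Integration.integral_diff iv[OF cont that] iv[OF contg that])
  have diff: "rect_integral f a b c d - rect_integral g a b c d =
      (integral {a..b} (\<lambda>x. ?\<phi> (x, c)) - integral {a..b} (\<lambda>x. ?\<phi> (x, d)))
       + \<i> * (integral {c..d} (\<lambda>y. ?\<phi> (b, y)) - integral {c..d} (\<lambda>y. ?\<phi> (a, y)))"
    unfolding expand[OF cont] expand[OF contg] dh'[OF mem(3)] dh'[OF mem(4)] dv'[OF mem(1)] dv'[OF mem(2)]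
    by (simp add: algebra_simps)
  have "norm (rect_integral f a b c d - rect_integral g a b c d) \<le> (norm (integral {a..b} (\<lambda>x. ?\<phi> (x, c))) + norm (integral {a..b} (\<lambda>x. ?\<phi> (x, d))))
       + (norm (integral {c..d} (\<lambda>y. ?\<phi> (b, y))) + norm (integral {c..d} (\<lambda>y. ?\<phi> (a, y))))"
    unfolding diff
    by (rule order.trans[OF norm_triangle_ineq], rule add_mono)
       (simp_all add: norm_mult norm_triangle_ineq4)
  also have "\<dots> \<le> (5 * N * (1 + ?rx) * ?m + 5 * N * (1 + ?rx) * ?m) + (5 * N * (1 + ?ry) * ?m + 5 * N * (1 + ?ry) * ?m)"
  proof (intro add_mono)
    have h: "norm (integral {a..b} (\<lambda>x. ?\<phi> (x, e))) \<le> integral {a..b} (\<lambda>x. \<delta> (x, e))" if "e \<in> {c..d}" for e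
      by (rule integral_norm_bound_integral) (auto simp: \<delta>_def intro: ih[OF c\<phi> that] ih[OF cont\<delta>[unfolded \<delta>_def] that])
    show "norm (integral {a..b} (\<lambda>x. ?\<phi> (x, c))) \<le> 5 * N * (1 + ?rx) * ?m"
      using h[OF mem(3)] hedge[OF mem(3) edges(1)] by simp
    show "norm (integral {a..b} (\<lambda>x. ?\<phi> (x, d))) \<le> 5 * N * (1 + ?rx) * ?m"
      using h[OF mem(4)] hedge[OF mem(4) edges(2)] by simp
    have v: "norm (integral {c..d} (\<lambda>y. ?\<phi> (e, y))) \<le> integral {c..d} (\<lambda>y. \<delta> (e, y))" if "e \<in> {a..b}" for e
      by (rule integral_norm_bound_integral) (auto simp: \<delta>_def intro: iv[OF c\<phi> that] iv[OF cont\<delta>[unfolded \<delta>_def] that])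
    show "norm (integral {c..d} (\<lambda>y. ?\<phi> (a, y))) \<le> 5 * N * (1 + ?ry) * ?m"
      using v[OF mem(1)] vedge[OF mem(1) edges(3)] by simp
    show "norm (integral {c..d} (\<lambda>y. ?\<phi> (b, y))) \<le> 5 * N * (1 + ?ry) * ?m"
      using v[OF mem(2)] vedge[OF mem(2) edges(4)] by simp
  qed
  finally have 1: "norm (rect_integral f a b c d - rect_integral g a b c d) \<le> N * (20 + 10 * (?rx + ?ry)) * ?m"
    by (simp add: algebra_simps)
  have "norm (rect_integral g a b c d) \<le> 2 * (4 * N) * measure lborel (?R - K)"
    by (rule norm_rect_integral_lipschitz_le[OF K ord(2,5) g(1) _ g(2) ae]) (use N in auto)
  also have "\<dots> \<le> 2 * (4 * N) * ?m"
  proof (intro mult_left_mono measure_mono_fmeasurable)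
    show "?R - K \<subseteq> ?Q - K" using ord by (auto simp: cbox_Pair_eq)
    show "?R - K \<in> sets lborel" "?Q - K \<in> fmeasurable lborel"
      using fmeasurable_compact_Diff[OF _ K(1)] by (auto simp: fmeasurable_def)
  qed (use N in auto)
  finally have 2: "norm (rect_integral g a b c d) \<le> 8 * N * ?m" by simp
  have "norm (rect_integral f a b c d) \<le>
      norm (rect_integral f a b c d - rect_integral g a b c d) + norm (rect_integral g a b c d)"
    by (metis diff_add_cancel norm_triangle_ineq)
  with 1 2 show ?thesis by (simp add: algebra_simps)
qed

section \<open>Rectangle integrals and holomorphic functions\<close>

lemma rect_integral_split_x:
  assumes "continuous_on (cbox (a, c) (b, d)) f" "a \<le> m" "m \<le> b" "c \<le> d"
  shows "rect_integral f a b c d = rect_integral f a m c d + rect_integral f m b c d"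
proof -
  have h: "(\<lambda>x. f (x, e)) integrable_on {a..b}" if "e \<in> {c..d}" for e
    by (rule integrable_continuous_real, rule continuous_on_compose2[OF assms(1)])
      (use that in \<open>auto intro!: continuous_intros simp: cbox_Pair_eq\<close>)
  have v: "(\<lambda>y. f (e, y)) integrable_on {c..d}" if "e \<in> {a..b}" for e
    by (rule integrable_continuous_real, rule continuous_on_compose2[OF assms(1)])
      (use that in \<open>auto intro!: continuous_intros simp: cbox_Pair_eq\<close>)
  have 1: "integral {a..b} (\<lambda>x. f (x, c) - f (x, d)) =
      integral {a..m} (\<lambda>x. f (x, c) - f (x, d)) + integral {m..b} (\<lambda>x. f (x, c) - f (x, d))"
    using assms h by (intro Henstock_Kurzweil_Integration.integral_combine[symmetric] integrable_diff) auto
  have *: "integral {c..d} (\<lambda>y. f (u, y) - f (v, y)) =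
      integral {c..d} (\<lambda>y. f (u, y)) - integral {c..d} (\<lambda>y. f (v, y))" if "u \<in> {a..b}" "v \<in> {a..b}" for u v
    using v that by (intro Henstock_Kurzweil_Integration.integral_diff) auto
  have 2: "integral {c..d} (\<lambda>y. f (b, y) - f (a, y)) =
      integral {c..d} (\<lambda>y. f (m, y) - f (a, y)) + integral {c..d} (\<lambda>y. f (b, y) - f (m, y))"
    using *[of b a] *[of b m] *[of m a] assms by simp
  show ?thesis
    unfolding rect_integral_def 1 2 by (simp add: algebra_simps)
qed

lemma rect_integral_split_y:
  assumes "continuous_on (cbox (a, c) (b, d)) f" "c \<le> m" "m \<le> d" "a \<le> b"
  shows "rect_integral f a b c d = rect_integral f a b c m + rect_integral f a b m d"
proof -
  have h: "(\<lambda>x. f (x, e)) integrable_on {a..b}" if "e \<in> {c..d}" for e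
    by (rule integrable_continuous_real, rule continuous_on_compose2[OF assms(1)])
      (use that in \<open>auto intro!: continuous_intros simp: cbox_Pair_eq\<close>)
  have v: "(\<lambda>y. f (e, y)) integrable_on {c..d}" if "e \<in> {a..b}" for e
    by (rule integrable_continuous_real, rule continuous_on_compose2[OF assms(1)])
      (use that in \<open>auto intro!: continuous_intros simp: cbox_Pair_eq\<close>)
  have 1: "integral {c..d} (\<lambda>y. f (b, y) - f (a, y)) =
      integral {c..m} (\<lambda>y. f (b, y) - f (a, y)) + integral {m..d} (\<lambda>y. f (b, y) - f (a, y))"
    using assms v by (intro Henstock_Kurzweil_Integration.integral_combine[symmetric] integrable_diff) auto
  have *: "integral {a..b} (\<lambda>x. f (x, u) - f (x, v)) =
      integral {a..b} (\<lambda>x. f (x, u)) - integral {a..b} (\<lambda>x. f (x, v))" if "u \<in> {c..d}" "v \<in> {c..d}" for u v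
    using h that by (intro Henstock_Kurzweil_Integration.integral_diff) auto
  have 2: "integral {a..b} (\<lambda>x. f (x, c) - f (x, d)) =
      integral {a..b} (\<lambda>x. f (x, c) - f (x, m)) + integral {a..b} (\<lambda>x. f (x, m) - f (x, d))"
    using *[of c d] *[of c m] *[of m d] assms by simp
  show ?thesis
    unfolding rect_integral_def 1 2 by (simp add: algebra_simps)
qed

definition cplx :: "real \<times> real \<Rightarrow> complex" where
  "cplx p = Complex (fst p) (snd p)"

lemma cplx_Pair [simp]: "cplx (x, y) = Complex x y"
  by (simp add: cplx_def)

lemma cplx_add: "cplx (p + q) = cplx p + cplx q"
  by (simp add: cplx_def complex_eq_iff)

lemma continuous_on_cplx [continuous_intros]: "continuous_on S cplx"
  unfolding cplx_def[abs_def] Complex_eq by (intro continuous_intros)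

lemma cplx_in_cbox_iff: "cplx p \<in> cbox (Complex a c) (Complex b d) \<longleftrightarrow> p \<in> cbox (a, c) (b, d)"
  by (cases p) (auto simp: in_cbox_complex_iff cbox_Pair_eq)

lemma continuous_on_comp_cplx:
  assumes "continuous_on (cbox (Complex a c) (Complex b d)) F"
  shows "continuous_on (cbox (a, c) (b, d)) (F \<circ> cplx)"
  unfolding o_def
  by (rule continuous_on_compose2[OF assms]) (auto simp: in_cbox_complex_iff cbox_Pair_eq intro!: continuous_intros)

text \<open>
  Holomorphy is assumed in the open rectangle only, so that the edges may touch the bad set; the
  primitive still exists on the closed rectangle.
\<close>

lemma rect_integral_eq_0_holomorphic:
  assumes "a \<le> b" "c \<le> d"
    and cont: "continuous_on (cbox (Complex a c) (Complex b d)) F"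
    and hol: "\<And>z. z \<in> box (Complex a c) (Complex b d) \<Longrightarrow> F field_differentiable at z"
  shows "rect_integral (F \<circ> cplx) a b c d = 0"
proof -
  let ?S = "cbox (Complex a c) (Complex b d)"
  have "\<And>z. z \<in> interior ?S - {} \<Longrightarrow> F field_differentiable at z"
    using hol by (simp add: interior_cbox)
  from holomorphic_convex_primitive[OF convex_box(1) finite.emptyI cont this]
  obtain G where G: "\<And>z. z \<in> ?S \<Longrightarrow> (G has_field_derivative F z) (at z within ?S)"
    by blast
  have h: "((\<lambda>x. F (Complex x y)) has_integral G (Complex b y) - G (Complex a y)) {a..b}" if y: "y \<in> {c..d}" for y
  proof (rule fundamental_theorem_of_calculus[OF \<open>a \<le> b\<close>])
    fix x assume x: "x \<in> {a..b}"
    have 1: "((\<lambda>x. Complex x y) has_vector_derivative 1) (at x within {a..b})"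
      unfolding Complex_eq by (auto intro!: derivative_eq_intros simp: has_vector_derivative_def scaleR_conv_of_real)
    have "(G has_field_derivative F (Complex x y)) (at (Complex x y) within (\<lambda>x. Complex x y) ` {a..b})"
      by (rule DERIV_subset[OF G]) (use x y in \<open>auto simp: in_cbox_complex_iff\<close>)
    from field_vector_diff_chain_within[OF 1 this]
    show "((\<lambda>x. G (Complex x y)) has_vector_derivative F (Complex x y)) (at x within {a..b})"
      by (simp add: o_def)
  qed
  have v: "((\<lambda>y. \<i> * F (Complex x y)) has_integral G (Complex x d) - G (Complex x c)) {c..d}" if x: "x \<in> {a..b}" for x
  proof (rule fundamental_theorem_of_calculus[OF \<open>c \<le> d\<close>])
    fix y assume y: "y \<in> {c..d}"
    have 1: "((\<lambda>y. Complex x y) has_vector_derivative \<i>) (at y within {c..d})"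
      unfolding Complex_eq by (auto intro!: derivative_eq_intros simp: has_vector_derivative_def scaleR_conv_of_real)
    have "(G has_field_derivative F (Complex x y)) (at (Complex x y) within (\<lambda>y. Complex x y) ` {c..d})"
      by (rule DERIV_subset[OF G]) (use x y in \<open>auto simp: in_cbox_complex_iff\<close>)
    from field_vector_diff_chain_within[OF 1 this]
    show "((\<lambda>y. G (Complex x y)) has_vector_derivative \<i> * F (Complex x y)) (at y within {c..d})"
      by (simp add: o_def)
  qed
  have mem: "a \<in> {a..b}" "b \<in> {a..b}" "c \<in> {c..d}" "d \<in> {c..d}" using assms by auto
  have H: "integral {a..b} (\<lambda>x. F (Complex x c) - F (Complex x d)) =
      (G (Complex b c) - G (Complex a c)) - (G (Complex b d) - G (Complex a d))"
    by (intro integral_unique has_integral_diff h mem)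
  have "\<i> * integral {c..d} (\<lambda>y. F (Complex b y) - F (Complex a y)) =
      integral {c..d} (\<lambda>y. \<i> * F (Complex b y) - \<i> * F (Complex a y))"
    by (simp flip: integral_mult_right add: right_diff_distrib)
  also have "\<dots> = (G (Complex b d) - G (Complex b c)) - (G (Complex a d) - G (Complex a c))"
    by (intro integral_unique has_integral_diff v mem)
  finally show ?thesis by (simp add: rect_integral_def H)
qed

text \<open>
  Morera's theorem for rectangles.  The integral of \<open>F\<close> from a corner, first horizontally and then
  vertically, has \<open>y\<close>-derivative \<open>\<i> F\<close>; by hypothesis the other order of the two legs gives the
  same value, hence the \<open>x\<close>-derivative is \<open>F\<close>.  So this integral is a complex primitive of \<open>F\<close>.
\<close>

lemma holomorphic_on_if_rect_integrals_eq_0: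
  assumes "open V" and cont: "continuous_on V F"
    and zero: "\<And>a b c d. a < b \<Longrightarrow> c < d \<Longrightarrow> cbox (Complex a c) (Complex b d) \<subseteq> V \<Longrightarrow>
      rect_integral (F \<circ> cplx) a b c d = 0"
  shows "F holomorphic_on V"
proof -
  have "F analytic_on V"
  proof (subst analytic_on_analytic_at, rule ballI)
    fix z0 assume "z0 \<in> V"
    from open_contains_cbox[OF \<open>open V\<close> this]
    obtain l u where lu: "z0 \<in> box l u" "cbox l u \<subseteq> V"
      by metis
    define a b c d where abcd: "a = Re l" "b = Re u" "c = Im l" "d = Im u"
    have lu': "l = Complex a c" "u = Complex b d" by (auto simp: abcd)
    have ord: "a < b" "c < d" using lu by (auto simp: in_box_complex_iff lu')
    let ?S = "cbox (Complex a c) (Complex b d)" and ?W = "box (Complex a c) (Complex b d)"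
    have contS: "continuous_on ?S F" using continuous_on_subset[OF cont] lu by (simp add: lu')
    have ch: "continuous_on {a'..b'} (\<lambda>x. F (Complex x y))" if "a \<le> a'" "b' \<le> b" "y \<in> {c..d}" for y a' b'
      by (rule continuous_on_compose2[OF contS])
        (use that in \<open>auto simp: in_cbox_complex_iff Complex_eq intro!: continuous_intros\<close>)
    have cv: "continuous_on {c'..d'} (\<lambda>y. F (Complex x y))" if "x \<in> {a..b}" "c \<le> c'" "d' \<le> d" for x c' d'
      by (rule continuous_on_compose2[OF contS])
        (use that in \<open>auto simp: in_cbox_complex_iff Complex_eq intro!: continuous_intros\<close>)
    define \<Phi> where "\<Phi> x y = integral {a..x} (\<lambda>t. F (Complex t c)) + \<i> * integral {c..y} (\<lambda>t. F (Complex x t))" for x y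
    have alt: "\<Phi> x y = integral {a..x} (\<lambda>t. F (Complex t y)) + \<i> * integral {c..y} (\<lambda>t. F (Complex a t))"
      if x: "x \<in> {a..b}" and y: "y \<in> {c<..<d}" for x y
    proof (cases "x = a")
      case True
      then show ?thesis by (simp add: \<Phi>_def)
    next
      case False
      have "rect_integral (F \<circ> cplx) a x c y = 0"
        using x y False lu by (intro zero) (auto simp: lu' in_cbox_complex_iff subset_eq)
      moreover have "integral {a..x} (\<lambda>t. F (Complex t c) - F (Complex t y)) =
          integral {a..x} (\<lambda>t. F (Complex t c)) - integral {a..x} (\<lambda>t. F (Complex t y))"
        using x y by (intro Henstock_Kurzweil_Integration.integral_diff integrable_continuous_real ch) auto
      moreover have "integral {c..y} (\<lambda>t. F (Complex x t) - F (Complex a t)) =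
          integral {c..y} (\<lambda>t. F (Complex x t)) - integral {c..y} (\<lambda>t. F (Complex a t))"
        using x y by (intro Henstock_Kurzweil_Integration.integral_diff integrable_continuous_real cv) auto
      ultimately show ?thesis by (simp add: \<Phi>_def rect_integral_def algebra_simps)
    qed
    have deriv: "((\<lambda>z. \<Phi> (Re z) (Im z)) has_field_derivative F z) (at z)" if z: "z \<in> ?W" for z
    proof -
      define x y where xy: "x = Re z" "y = Im z"
      have x: "x \<in> {a<..<b}" and y: "y \<in> {c<..<d}" using z by (auto simp: in_box_complex_iff xy)
      have "((\<lambda>(x, y). \<Phi> x y) has_derivative
          (\<lambda>(tx, ty). tx *\<^sub>R F (Complex x y) + blinfun_apply (blinfun_scaleR_left (\<i> * F (Complex x y))) ty))
          (at (x, y) within {a..b} \<times> {c..d})"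
      proof (rule has_derivative_partialsI)
        have "((\<lambda>x. integral {a..x} (\<lambda>t. F (Complex t y)) + \<i> * integral {c..y} (\<lambda>t. F (Complex a t)))
            has_vector_derivative F (Complex x y) + 0) (at x within {a..b})"
          using x y by (intro has_vector_derivative_add integral_has_vector_derivative ch) auto
        from has_vector_derivative_transform[OF _ _ this, of "\<lambda>x. \<Phi> x y"]
        have "((\<lambda>x. \<Phi> x y) has_vector_derivative F (Complex x y)) (at x within {a..b})"
          using x y alt by simp
        then show "((\<lambda>x. \<Phi> x y) has_derivative (\<lambda>tx. tx *\<^sub>R F (Complex x y))) (at x within {a..b})"
          by (simp add: has_vector_derivative_def)
        fix x' y' assume xy': "x' \<in> {a..b}" "y' \<in> {c..d}"
        have "((\<lambda>y. integral {a..x'} (\<lambda>t. F (Complex t c)) + \<i> * integral {c..y} (\<lambda>t. F (Complex x' t)))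
            has_vector_derivative 0 + \<i> * F (Complex x' y')) (at y' within {c..d})"
          using xy' by (intro has_vector_derivative_add has_vector_derivative_mult_right integral_has_vector_derivative cv) auto
        then show "((\<lambda>y. \<Phi> x' y) has_derivative blinfun_apply (blinfun_scaleR_left (\<i> * F (Complex x' y')))) (at y' within {c..d})"
          by (simp add: has_vector_derivative_def \<Phi>_def[abs_def])
      next
        have cc: "continuous_on ({a..b} \<times> {c..d}) (F \<circ> cplx)"
          using continuous_on_comp_cplx[OF contS] unfolding cbox_Pair_eq box_real .
        have "continuous_on ({a..b} \<times> {c..d}) (\<lambda>p. blinfun_scaleR_left (\<i> * (F \<circ> cplx) p))"
          by (intro bounded_linear.continuous_on[OF bounded_linear_blinfun_scaleR_left] continuous_on_mult_left cc)
        then show "continuous (at (x, y) within {a..b} \<times> {c..d})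
            (\<lambda>(x, y). blinfun_scaleR_left (\<i> * F (Complex x y)))"
          using x y by (auto simp: continuous_on_eq_continuous_within case_prod_unfold cplx_def[abs_def] o_def)
      qed (use y in auto)
      moreover have "at (x, y) within {a..b} \<times> {c..d} = at (x, y)"
      proof (rule at_within_interior)
        show "(x, y) \<in> interior ({a..b} \<times> {c..d})" using x y by (simp add: interior_Times)
      qed
      ultimately have "((\<lambda>(x, y). \<Phi> x y) has_derivative
          (\<lambda>(tx, ty). tx *\<^sub>R F z + ty *\<^sub>R (\<i> * F z))) (at (Re z, Im z))"
        by (simp add: xy)
      moreover have "((\<lambda>z. (Re z, Im z)) has_derivative (\<lambda>z. (Re z, Im z))) (at z)"
        by (intro has_derivative_Pair bounded_linear_imp_has_derivative bounded_linear_Re bounded_linear_Im)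
      ultimately have "((\<lambda>(x, y). \<Phi> x y) \<circ> (\<lambda>z. (Re z, Im z)) has_derivative
          (\<lambda>(tx, ty). tx *\<^sub>R F z + ty *\<^sub>R (\<i> * F z)) \<circ> (\<lambda>z. (Re z, Im z))) (at z)"
        by (intro diff_chain_at)
      moreover have "(\<lambda>(tx, ty). tx *\<^sub>R F z + ty *\<^sub>R (\<i> * F z)) \<circ> (\<lambda>z. (Re z, Im z)) = (*) (F z)"
        by (auto simp: fun_eq_iff complex_eq_iff algebra_simps)
      ultimately show ?thesis by (simp add: has_field_derivative_def o_def)
    qed
    have "(\<lambda>z. \<Phi> (Re z) (Im z)) holomorphic_on ?W"
      using deriv by (auto simp: holomorphic_on_open open_box)
    then have "deriv (\<lambda>z. \<Phi> (Re z) (Im z)) holomorphic_on ?W"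
      by (intro holomorphic_deriv open_box)
    then have "F holomorphic_on ?W"
      by (rule holomorphic_transform) (use deriv DERIV_imp_deriv in blast)
    then show "F analytic_on {z0}"
      using lu by (auto simp: analytic_at lu' intro: open_box)
  qed
  then show ?thesis by (rule analytic_imp_holomorphic)
qed

text \<open>
  Cutting \<open>Q\<close> along the four sides of the smallest rectangle around \<open>K = E \<inter> Q\<close> leaves outer pieces
  whose interiors avoid \<open>E\<close>, where the boundary integral vanishes.  Hence the boundary integrals of
  \<open>Q\<close> and of that smallest rectangle coincide, and Menchoff's estimate applies to the latter.
\<close>

lemma rect_integral_le_measure_Diff:
  fixes F :: "complex \<Rightarrow> complex"
  assumes ord: "p < q" "s < t"
    and cont: "continuous_on (cbox (Complex p s) (Complex q t)) F"
    and K: "K = {u \<in> cbox (p, s) (q, t). cplx u \<in> E}" "closed E"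
    and hol: "\<And>z. z \<in> box (Complex p s) (Complex q t) - E \<Longrightarrow> F field_differentiable at z"
    and N: "0 \<le> N"
    and lip: "\<And>z w. z \<in> E \<inter> cbox (Complex p s) (Complex q t) \<Longrightarrow> w \<in> cbox (Complex p s) (Complex q t) \<Longrightarrow>
        Re w = Re z \<or> Im w = Im z \<Longrightarrow> norm (F w - F z) \<le> N * norm (w - z)"
    and ae: "AE u in lborel. u \<in> K \<longrightarrow> (\<lambda>n. dbar_quotient (F \<circ> cplx) n u) \<longlonglongrightarrow> 0"
  shows "norm (rect_integral (F \<circ> cplx) p q s t) \<le>
    N * (28 + 10 * ((q - p) / (t - s) + (t - s) / (q - p))) * measure lborel (cbox (p, s) (q, t) - K)"
    and "K = {} \<Longrightarrow> rect_integral (F \<circ> cplx) p q s t = 0"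
proof -
  let ?f = "F \<circ> cplx" and ?Q = "cbox (p, s) (q, t)"
  have zero: "rect_integral ?f a b c d = 0"
    if "p \<le> a" "a \<le> b" "b \<le> q" "s \<le> c" "c \<le> d" "d \<le> t"
      and free: "\<And>x y. (x, y) \<in> K \<Longrightarrow> x \<notin> {a<..<b} \<or> y \<notin> {c<..<d}" for a b c d
  proof (rule rect_integral_eq_0_holomorphic)
    show "continuous_on (cbox (Complex a c) (Complex b d)) F"
      by (rule continuous_on_subset[OF cont]) (use that in \<open>auto simp: in_cbox_complex_iff\<close>)
    fix z assume z: "z \<in> box (Complex a c) (Complex b d)"
    have "z \<notin> E"
    proof
      assume "z \<in> E"
      then have "(Re z, Im z) \<in> K"
        using z that by (auto simp: K(1) in_box_complex_iff cbox_Pair_eq)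
      with free z show False by (force simp: in_box_complex_iff)
    qed
    then show "F field_differentiable at z"
      using z that by (intro hol) (auto simp: in_box_complex_iff)
  qed (use that in auto)
  show zero_empty: "K = {} \<Longrightarrow> rect_integral ?f p q s t = 0"
    using zero[of p q s t] ord by auto
  have cK: "compact K"
  proof -
    have "K = ?Q \<inter> cplx -` E" by (auto simp: K)
    moreover have "closed (cplx -` E)"
      by (rule closed_vimage[OF K(2) continuous_on_cplx])
    ultimately show ?thesis by (simp add: compact_Int_closed compact_cbox)
  qed
  have contf: "continuous_on ?Q ?f" by (rule continuous_on_comp_cplx[OF cont])
  show "norm (rect_integral ?f p q s t) \<le>
    N * (28 + 10 * ((q - p) / (t - s) + (t - s) / (q - p))) * measure lborel (?Q - K)" (is "_ \<le> ?B")
  proof (cases "K = {}")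
    case True
    have "0 \<le> ?B" using N ord by (intro mult_nonneg_nonneg) auto
    then show ?thesis using zero_empty[OF True] by simp
  next
    case False
    have fs: "continuous_on K fst" "continuous_on K snd" by (auto intro!: continuous_intros)
    obtain a ya where a: "(a, ya) \<in> K" "\<And>x y. (x, y) \<in> K \<Longrightarrow> a \<le> x"
      using continuous_attains_inf[OF cK False fs(1)] by force
    obtain b yb where b: "(b, yb) \<in> K" "\<And>x y. (x, y) \<in> K \<Longrightarrow> x \<le> b"
      using continuous_attains_sup[OF cK False fs(1)] by force
    obtain xc c where c: "(xc, c) \<in> K" "\<And>x y. (x, y) \<in> K \<Longrightarrow> c \<le> y"
      using continuous_attains_inf[OF cK False fs(2)] by force
    obtain xd d where d: "(xd, d) \<in> K" "\<And>x y. (x, y) \<in> K \<Longrightarrow> y \<le> d"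
      using continuous_attains_sup[OF cK False fs(2)] by force
    have KQ: "p \<le> x" "x \<le> q" "s \<le> y" "y \<le> t" if "(x, y) \<in> K" for x y
      using that by (auto simp: K cbox_Pair_eq)
    have o: "p \<le> a" "a \<le> b" "b \<le> q" "s \<le> c" "c \<le> d" "d \<le> t"
      using KQ[OF a(1)] KQ[OF b(1)] KQ[OF c(1)] KQ[OF d(1)] a(2)[OF b(1)] c(2)[OF d(1)] by auto
    have sub: "continuous_on (cbox (a', c') (b', d')) ?f" if "p \<le> a'" "b' \<le> q" "s \<le> c'" "d' \<le> t" for a' b' c' d'
      by (rule continuous_on_subset[OF contf]) (use that in \<open>auto simp: cbox_Pair_eq\<close>)
    have "rect_integral ?f p q s t = rect_integral ?f p a s t + rect_integral ?f a q s t"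
      using o ord by (intro rect_integral_split_x sub) auto
    also have "rect_integral ?f p a s t = 0"
      using o ord a(2) by (intro zero) force+
    also have "rect_integral ?f a q s t = rect_integral ?f a b s t + rect_integral ?f b q s t"
      using o ord by (intro rect_integral_split_x sub) auto
    also have "rect_integral ?f b q s t = 0"
      using o ord b(2) by (intro zero) force+
    also have "rect_integral ?f a b s t = rect_integral ?f a b s c + rect_integral ?f a b c t"
      using o ord by (intro rect_integral_split_y sub) auto
    also have "rect_integral ?f a b s c = 0"
      using o ord c(2) by (intro zero) force+
    also have "rect_integral ?f a b c t = rect_integral ?f a b c d + rect_integral ?f a b d t"
      using o ord by (intro rect_integral_split_y sub) auto
    also have "rect_integral ?f a b d t = 0"
      using o ord d(2) by (intro zero) force+
    finally have "rect_integral ?f p q s t = rect_integral ?f a b c d"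
      by (simp only: add_0_left add_0_right)
    also have "norm \<dots> \<le> ?B"
    proof (rule norm_rect_integral_le_measure_outside[OF cK _ c(1) d(1) a(1) b(1)])
      show "K \<subseteq> cbox (a, c) (b, d)" using a(2) b(2) c(2) d(2) by (force simp: cbox_Pair_eq)
      show "continuous_on (cbox (a, c) (b, d)) ?f" using o by (intro sub) auto
      show "norm (?f (x', y) - ?f (x, y)) \<le> N * \<bar>x' - x\<bar>" if "(x, y) \<in> K" "x' \<in> {a..b}" for x y x'
      proof -
        have "norm (F (Complex x' y) - F (Complex x y)) \<le> N * norm (Complex x' y - Complex x y)"
          using that o KQ[OF that(1)] by (intro lip) (auto simp: K in_cbox_complex_iff)
        then show ?thesis by (simp add: norm_complex_def)
      qed
      show "norm (?f (x, y') - ?f (x, y)) \<le> N * \<bar>y' - y\<bar>" if "(x, y) \<in> K" "y' \<in> {c..d}" for x y y'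
      proof -
        have "norm (F (Complex x y') - F (Complex x y)) \<le> N * norm (Complex x y' - Complex x y)"
          using that o KQ[OF that(1)] by (intro lip) (auto simp: K in_cbox_complex_iff)
        then show ?thesis by (simp add: norm_complex_def)
      qed
    qed (use o ord N ae in auto)
    finally show ?thesis .
  qed
qed

text \<open>
  Half-open rectangles, unlike closed ones, are disjoint unions of their quarters, so that
  measures add exactly under bisection.
\<close>

definition half_open_rect :: "real \<Rightarrow> real \<Rightarrow> real \<Rightarrow> real \<Rightarrow> (real \<times> real) set" where
  "half_open_rect p q s t = {p<..q} \<times> {s<..t}"

lemma measure_half_open_rect_split:
  assumes "T \<in> fmeasurable lborel" "p \<le> m" "m \<le> q" "s \<le> k" "k \<le> t"
  shows "measure lborel (half_open_rect p q s t \<inter> T) =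
    measure lborel (half_open_rect p m s k \<inter> T) + measure lborel (half_open_rect p m k t \<inter> T) +
    (measure lborel (half_open_rect m q s k \<inter> T) + measure lborel (half_open_rect m q k t \<inter> T))"
proof -
  have b: "half_open_rect a b c d \<in> sets borel" for a b c d
    unfolding half_open_rect_def by (intro borel_Times) auto
  have fm: "half_open_rect a b c d \<inter> T \<in> fmeasurable lborel" for a b c d
    using fmeasurable_Int_fmeasurable[OF assms(1), of "half_open_rect a b c d"] b by (simp add: Int_commute)
  have un: "measure lborel (A \<union> B) = measure lborel A + measure lborel B"
    if "A \<in> fmeasurable lborel" "B \<in> fmeasurable lborel" "A \<inter> B = {}" for A B :: "(real \<times> real) set"
    using that by (intro measure_Union) (auto simp: fmeasurable_def)
  have "half_open_rect p q s t \<inter> T = (half_open_rect p m s k \<inter> T \<union> half_open_rect p m k t \<inter> T) \<union> (half_open_rect m q s k \<inter> T \<union> half_open_rect m q k t \<inter> T)"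
    using assms(2-) by (auto simp: half_open_rect_def)
  moreover have "(half_open_rect p m s k \<inter> T \<union> half_open_rect p m k t \<inter> T) \<inter> (half_open_rect m q s k \<inter> T \<union> half_open_rect m q k t \<inter> T) = {}"
    "(half_open_rect p m s k \<inter> T) \<inter> (half_open_rect p m k t \<inter> T) = {}" "(half_open_rect m q s k \<inter> T) \<inter> (half_open_rect m q k t \<inter> T) = {}"
    by (auto simp: half_open_rect_def)
  ultimately show ?thesis by (simp only: un fm fmeasurable.Un)
qed

text \<open>
  Bisecting \<open>m\<close> times keeps the aspect ratio, hence the constant.  A small rectangle that meets \<open>E\<close>
  lies within its own diameter of \<open>K0\<close>, while one that misses \<open>E\<close> contributes nothing, so only the
  measure of the collar of \<open>K0\<close> of width proportional to \<open>1 / 2 ^ m\<close> enters the bound.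
\<close>

lemma rect_integral_le_collar:
  fixes F :: "complex \<Rightarrow> complex"
  assumes cont: "continuous_on (cbox (Complex p0 s0) (Complex q0 t0)) F"
    and K0: "K0 = {u \<in> cbox (p0, s0) (q0, t0). cplx u \<in> E}" "closed E"
    and hol: "\<And>z. z \<in> box (Complex p0 s0) (Complex q0 t0) - E \<Longrightarrow> F field_differentiable at z"
    and N: "0 \<le> N"
    and lip: "\<And>z w. z \<in> E \<inter> cbox (Complex p0 s0) (Complex q0 t0) \<Longrightarrow> w \<in> cbox (Complex p0 s0) (Complex q0 t0) \<Longrightarrow>
        Re w = Re z \<or> Im w = Im z \<Longrightarrow> norm (F w - F z) \<le> N * norm (w - z)"
    and ae: "AE u in lborel. u \<in> K0 \<longrightarrow> (\<lambda>n. dbar_quotient (F \<circ> cplx) n u) \<longlonglongrightarrow> 0"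
    and ord: "p < q" "s < t" "p0 \<le> p" "q \<le> q0" "s0 \<le> s" "t \<le> t0"
    and \<rho>: "(q - p) / (t - s) + (t - s) / (q - p) = \<rho>"
  shows "norm (rect_integral (F \<circ> cplx) p q s t) \<le> N * (28 + 10 * \<rho>) *
    measure lborel (half_open_rect p q s t \<inter> ({x + y | x y. x \<in> K0 \<and> y \<in> cball 0 (((q - p) + (t - s)) / 2 ^ m)} - K0))"
  using ord \<rho>
proof (induction m arbitrary: p q s t)
  have cK0: "compact K0"
  proof -
    have "K0 = cbox (p0, s0) (q0, t0) \<inter> cplx -` E" by (auto simp: K0)
    moreover have "closed (cplx -` E)"
      by (rule closed_vimage[OF K0(2) continuous_on_cplx])
    ultimately show ?thesis by (simp add: compact_Int_closed compact_cbox)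
  qed
  have fm: "{x + y | x y. x \<in> K0 \<and> y \<in> cball 0 \<delta>} - K0 \<in> fmeasurable lborel" for \<delta>
    by (intro fmeasurable_compact_Diff compact_sums cK0 compact_cball)
  {
    case (0 p q s t)
    let ?Q = "cbox (p, s) (q, t)"
    let ?T = "{x + y | x y. x \<in> K0 \<and> y \<in> cball 0 (((q - p) + (t - s)) / 2 ^ 0)} - K0"
    define K where "K = {u \<in> ?Q. cplx u \<in> E}"
    have sub: "cbox (Complex p s) (Complex q t) \<subseteq> cbox (Complex p0 s0) (Complex q0 t0)"
      using 0 by (auto simp: in_cbox_complex_iff)
    have K': "K = K0 \<inter> ?Q"
      using 0 by (auto simp: K_def K0 cbox_Pair_eq)
    have ae': "AE u in lborel. u \<in> K \<longrightarrow> (\<lambda>n. dbar_quotient (F \<circ> cplx) n u) \<longlonglongrightarrow> 0"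
      using ae by eventually_elim (simp add: K')
    have hol': "F field_differentiable at z" if "z \<in> box (Complex p s) (Complex q t) - E" for z
      using that 0 by (intro hol) (auto simp: in_box_complex_iff)
    have lip': "norm (F w - F z) \<le> N * norm (w - z)"
      if "z \<in> E \<inter> cbox (Complex p s) (Complex q t)" "w \<in> cbox (Complex p s) (Complex q t)"
        "Re w = Re z \<or> Im w = Im z" for z w
      using that sub by (intro lip) auto
    note * = rect_integral_le_measure_Diff[OF 0(1,2) continuous_on_subset[OF cont sub] K_def K0(2) _ N _ ae']
    have bound: "norm (rect_integral (F \<circ> cplx) p q s t) \<le>
        N * (28 + 10 * ((q - p) / (t - s) + (t - s) / (q - p))) * measure lborel (?Q - K)"
      by (rule *(1)) (fact hol' lip')+
    have empty: "rect_integral (F \<circ> cplx) p q s t = 0" if "K = {}"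
      using that by (rule *(2)[rotated 2]) (fact hol' lip')+
    show ?case
    proof (cases "K = {}")
      case True
      have "0 \<le> \<rho>" using 0 by auto
      then show ?thesis unfolding empty[OF True] using N by simp
    next
      case False
      then obtain x1 y1 where "(x1, y1) \<in> K" by auto
      then have k: "(x1, y1) \<in> K0" "x1 \<in> {p..q}" "y1 \<in> {s..t}"
        by (simp_all add: K' cbox_Pair_eq)
      \<comment> \<open>The two closed edges that the half-open rectangle omits.\<close>
      let ?L = "cbox (p, s) (p, t) \<union> cbox (p, s) (q, s)"
      have null: "?L \<in> null_sets lborel"
        by (intro null_sets.Un) (auto simp: null_sets_def emeasure_lborel_cbox_eq Basis_prod_def)
      have TI: "half_open_rect p q s t \<inter> ?T \<in> fmeasurable lborel"
      proof -
        have "half_open_rect p q s t \<in> sets borel" unfolding half_open_rect_def by (intro borel_Times) auto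
        then show ?thesis using fmeasurable_Int_fmeasurable[OF fm] by (simp add: Int_commute)
      qed
      have "?Q - K \<subseteq> (half_open_rect p q s t \<inter> ?T) \<union> ?L"
      proof
        fix u assume u: "u \<in> ?Q - K"
        obtain x y where xy: "u = (x, y)" by (cases u)
        have uK: "u \<notin> K0" using u by (auto simp: K')
        have "norm (x - x1, y - y1) \<le> \<bar>x - x1\<bar> + \<bar>y - y1\<bar>"
          using norm_Pair_le[of "x - x1" "y - y1"] by simp
        also have "\<dots> \<le> (q - p) + (t - s)" using u k by (auto simp: xy cbox_Pair_eq)
        finally have "u \<in> {x + y | x y. x \<in> K0 \<and> y \<in> cball 0 (((q - p) + (t - s)) / 2 ^ 0)}"
          using k(1) by (intro CollectI exI[of _ "(x1, y1)"] exI[of _ "(x - x1, y - y1)"]) (auto simp: xy)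
        then show "u \<in> (half_open_rect p q s t \<inter> ?T) \<union> ?L"
          using u uK by (auto simp: xy half_open_rect_def cbox_Pair_eq)
      qed
      then have "measure lborel (?Q - K) \<le> measure lborel ((half_open_rect p q s t \<inter> ?T) \<union> ?L)"
      proof (rule measure_mono_fmeasurable)
        show "?Q - K \<in> sets lborel"
          unfolding K' by (intro fmeasurableD fmeasurable_compact_Diff compact_cbox compact_Int_closed cK0 closed_cbox)
        show "(half_open_rect p q s t \<inter> ?T) \<union> ?L \<in> fmeasurable lborel"
          using TI null by (intro fmeasurable.Un) (auto intro: fmeasurableI_null_sets)
      qed
      also have "\<dots> = measure lborel (half_open_rect p q s t \<inter> ?T)"
        using TI null by (intro measure_Un_null_set) (auto simp: fmeasurable_def)
      finally have m: "measure lborel (?Q - K) \<le> measure lborel (half_open_rect p q s t \<inter> ?T)" .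
      have "norm (rect_integral (F \<circ> cplx) p q s t) \<le> N * (28 + 10 * \<rho>) * measure lborel (?Q - K)"
        using bound 0(7) by simp
      also have "\<dots> \<le> N * (28 + 10 * \<rho>) * measure lborel (half_open_rect p q s t \<inter> ?T)"
      proof (rule mult_left_mono[OF m])
        have "0 \<le> \<rho>" using 0 by auto
        then show "0 \<le> N * (28 + 10 * \<rho>)" using N by simp
      qed
      finally show ?thesis .
    qed
  next
    case (Suc m p q s t)
    define x where "x = (p + q) / 2"
    define y where "y = (s + t) / 2"
    let ?T = "{x + y | x y. x \<in> K0 \<and> y \<in> cball 0 (((q - p) + (t - s)) / 2 ^ Suc m)} - K0"
    let ?C = "N * (28 + 10 * \<rho>)"
    have xy: "p < x" "x < q" "s < y" "y < t" using Suc.prems by (auto simp: x_def y_def)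
    have half: "x - p = (q - p) / 2" "q - x = (q - p) / 2" "y - s = (t - s) / 2" "t - y = (t - s) / 2"
      by (auto simp: x_def y_def field_simps)
    have IH: "norm (rect_integral (F \<circ> cplx) a b c d) \<le> ?C * measure lborel (half_open_rect a b c d \<inter> ?T)"
      if "p \<le> a" "b \<le> q" "s \<le> c" "d \<le> t" and h: "b - a = (q - p) / 2" "d - c = (t - s) / 2" for a b c d
    proof -
      have scale: "u / 2 / (v / 2) = u / v" for u v :: real by simp
      have ratio: "(b - a) / (d - c) + (d - c) / (b - a) = \<rho>"
        unfolding h scale by (rule Suc.prems(7))
      have radius: "((b - a) + (d - c)) / 2 ^ m = ((q - p) + (t - s)) / 2 ^ Suc m"
        unfolding h by (simp add: field_simps)
      have "a < b" "c < d" "p0 \<le> a" "b \<le> q0" "s0 \<le> c" "d \<le> t0"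
        using h that(1-4) Suc.prems by auto
      from Suc.IH[OF this ratio] show ?thesis unfolding radius .
    qed
    have sub: "continuous_on (cbox (a', c') (b', d')) (F \<circ> cplx)" if "p \<le> a'" "b' \<le> q" "s \<le> c'" "d' \<le> t" for a' b' c' d'
      by (rule continuous_on_subset[OF continuous_on_comp_cplx[OF cont]])
        (use that Suc.prems in \<open>auto simp: cbox_Pair_eq\<close>)
    let ?r = "rect_integral (F \<circ> cplx)"
    have "?r p q s t = ?r p x s t + ?r x q s t"
      using xy Suc.prems by (intro rect_integral_split_x sub) auto
    moreover have "?r p x s t = ?r p x s y + ?r p x y t"
      using xy Suc.prems by (intro rect_integral_split_y sub) auto
    moreover have "?r x q s t = ?r x q s y + ?r x q y t"
      using xy Suc.prems by (intro rect_integral_split_y sub) auto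
    ultimately have "norm (?r p q s t) = norm ((?r p x s y + ?r p x y t) + (?r x q s y + ?r x q y t))" by simp
    also have "\<dots> \<le> (norm (?r p x s y) + norm (?r p x y t)) + (norm (?r x q s y) + norm (?r x q y t))"
      by (intro order.trans[OF norm_triangle_ineq] add_mono order.refl norm_triangle_ineq)
    also have "\<dots> \<le> (?C * measure lborel (half_open_rect p x s y \<inter> ?T) + ?C * measure lborel (half_open_rect p x y t \<inter> ?T)) +
        (?C * measure lborel (half_open_rect x q s y \<inter> ?T) + ?C * measure lborel (half_open_rect x q y t \<inter> ?T))"
      by (intro add_mono IH half) (use xy in auto)
    also have "\<dots> = ?C * measure lborel (half_open_rect p q s t \<inter> ?T)"
      using xy by (subst measure_half_open_rect_split[OF fm, of p x q s y t]) (auto simp: algebra_simps)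
    finally show ?case .
  }
qed

text \<open>
  The collars shrink to the compact set \<open>K\<close> itself, so their measure outside \<open>K\<close> tends to zero and
  every rectangle integral vanishes.
\<close>

lemma holomorphic_on_if_axis_lipschitz:
  fixes F :: "complex \<Rightarrow> complex"
  assumes "open V" "closed E" and cont: "continuous_on V F"
    and hol: "F holomorphic_on (V - E)"
    and lip: "\<And>z w. z \<in> E \<inter> V \<Longrightarrow> w \<in> V \<Longrightarrow> Re w = Re z \<or> Im w = Im z \<Longrightarrow>
        norm (F w - F z) \<le> N * norm (w - z)"
    and ae: "AE u in lborel. cplx u \<in> E \<inter> V \<longrightarrow> (\<lambda>n. dbar_quotient (F \<circ> cplx) n u) \<longlonglongrightarrow> 0"
  shows "F holomorphic_on V"
proof (rule holomorphic_on_if_rect_integrals_eq_0[OF \<open>open V\<close> cont])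
  fix p q s t :: real
  assume ord: "p < q" "s < t" and V: "cbox (Complex p s) (Complex q t) \<subseteq> V"
  let ?r = "rect_integral (F \<circ> cplx) p q s t"
  define K where "K = {u \<in> cbox (p, s) (q, t). cplx u \<in> E}"
  define \<rho> where "\<rho> = (q - p) / (t - s) + (t - s) / (q - p)"
  define C where "C = \<bar>N\<bar> * (28 + 10 * \<rho>)"
  have C: "0 \<le> C" using ord by (simp add: C_def \<rho>_def)
  have cK: "compact K"
  proof -
    have "K = cbox (p, s) (q, t) \<inter> cplx -` E" by (auto simp: K_def)
    moreover have "closed (cplx -` E)"
      by (rule closed_vimage[OF \<open>closed E\<close> continuous_on_cplx])
    ultimately show ?thesis by (simp add: compact_Int_closed compact_cbox)
  qed
  have "norm ?r \<le> C * e" if "0 < e" for e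
  proof -
    obtain \<delta> where \<delta>: "0 < \<delta>" "measure lborel ({x + y | x y. x \<in> K \<and> y \<in> cball 0 \<delta>} - K) < e"
      using measure_collar_small[OF cK \<open>0 < e\<close>] .
    obtain m where m: "((q - p) + (t - s)) / \<delta> < 2 ^ m"
      using real_arch_pow[of 2] by auto
    let ?T = "\<lambda>d. {x + y | x y. x \<in> K \<and> y \<in> cball 0 d} - K"
    have fm: "?T d \<in> fmeasurable lborel" for d
      by (intro fmeasurable_compact_Diff compact_sums cK compact_cball)
    have "norm ?r \<le> C * measure lborel (half_open_rect p q s t \<inter> ?T (((q - p) + (t - s)) / 2 ^ m))"
      unfolding C_def
    proof (rule rect_integral_le_collar[OF _ K_def \<open>closed E\<close>])
      show "continuous_on (cbox (Complex p s) (Complex q t)) F"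
        by (rule continuous_on_subset[OF cont V])
      show "F field_differentiable at z" if "z \<in> box (Complex p s) (Complex q t) - E" for z
      proof -
        have "z \<in> V - E" using that V box_subset_cbox by blast
        then show ?thesis
          using hol \<open>open V\<close> \<open>closed E\<close> by (auto intro: holomorphic_on_imp_differentiable_at open_Diff)
      qed
      show "norm (F w - F z) \<le> \<bar>N\<bar> * norm (w - z)"
        if "z \<in> E \<inter> cbox (Complex p s) (Complex q t)" "w \<in> cbox (Complex p s) (Complex q t)"
        "Re w = Re z \<or> Im w = Im z" for z w
      proof -
        have "norm (F w - F z) \<le> N * norm (w - z)" using that V by (intro lip) auto
        also have "\<dots> \<le> \<bar>N\<bar> * norm (w - z)" by (intro mult_right_mono) auto
        finally show ?thesis .
      qed
      show "AE u in lborel. u \<in> K \<longrightarrow> (\<lambda>n. dbar_quotient (F \<circ> cplx) n u) \<longlonglongrightarrow> 0"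
        using ae
      proof eventually_elim
        case (elim u)
        have "cplx u \<in> E \<inter> V" if "u \<in> K"
          using that V cplx_in_cbox_iff[of u p s q t] by (auto simp: K_def)
        with elim show ?case by blast
      qed
    qed (use ord in \<open>auto simp: \<rho>_def\<close>)
    also have "\<dots> \<le> C * measure lborel (?T \<delta>)"
    proof (intro mult_left_mono C measure_mono_fmeasurable fm)
      have "((q - p) + (t - s)) / 2 ^ m \<le> \<delta>"
        using m \<open>0 < \<delta>\<close> by (simp add: field_simps)
      then show "half_open_rect p q s t \<inter> ?T (((q - p) + (t - s)) / 2 ^ m) \<subseteq> ?T \<delta>" by force
      have "half_open_rect p q s t \<in> sets borel" unfolding half_open_rect_def by (intro borel_Times) auto
      then show "half_open_rect p q s t \<inter> ?T (((q - p) + (t - s)) / 2 ^ m) \<in> sets lborel"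
        using fm by (auto simp: fmeasurable_def)
    qed
    also have "\<dots> \<le> C * e" using C \<delta> by (intro mult_left_mono) auto
    finally show ?thesis .
  qed
  note small = this
  have "norm ?r \<le> 0"
  proof (rule field_le_epsilon)
    fix e :: real assume "0 < e"
    have "norm ?r \<le> C * (e / (C + 1))" using C \<open>0 < e\<close> by (intro small) auto
    also have "\<dots> \<le> 0 + e" using C \<open>0 < e\<close> by (simp add: field_simps)
    finally show "norm ?r \<le> 0 + e" .
  qed
  then show "?r = 0" by simp
qed

section \<open>The Looman-Menchoff theorem\<close>

lemma AE_cplx_if_AE_lebesgue_on:
  assumes "open \<Omega>" and ae: "AE z in lebesgue_on \<Omega>. P z"
  shows "AE u in lborel. cplx u \<in> \<Omega> \<longrightarrow> P (cplx u)"
proof -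
  have \<Omega>: "\<Omega> \<in> sets lebesgue" using \<open>open \<Omega>\<close> by (simp add: borel_open)
  have "AE z in lebesgue. z \<in> \<Omega> \<longrightarrow> P z"
    using ae \<Omega> by (simp add: AE_restrict_space_iff)
  then obtain Z where Z: "Z \<in> null_sets lebesgue" "{z. \<not> (z \<in> \<Omega> \<longrightarrow> P z)} \<subseteq> Z"
    by (auto simp: eventually_ae_filter)
  have "negligible ((\<lambda>z. (Re z, Im z)) ` Z)"
  proof (rule negligible_differentiable_image_negligible)
    show "negligible Z" using Z by (simp add: negligible_iff_null_sets)
    have "(\<lambda>z. (Re z, Im z)) differentiable at z within Z" for z
      by (intro bounded_linear_imp_differentiable bounded_linear_Pair bounded_linear_Re bounded_linear_Im)
    then show "(\<lambda>z. (Re z, Im z)) differentiable_on Z" by (simp add: differentiable_on_def)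
  qed simp
  then have "(\<lambda>z. (Re z, Im z)) ` Z \<in> null_sets lebesgue" by (simp add: negligible_iff_null_sets)
  moreover have "{u. \<not> (cplx u \<in> \<Omega> \<longrightarrow> P (cplx u))} \<subseteq> (\<lambda>z. (Re z, Im z)) ` Z"
  proof
    fix u assume "u \<in> {u. \<not> (cplx u \<in> \<Omega> \<longrightarrow> P (cplx u))}"
    then have "cplx u \<in> Z" using Z by auto
    then show "u \<in> (\<lambda>z. (Re z, Im z)) ` Z"
      by (intro image_eqI[of _ _ "cplx u"]) (auto simp: cplx_def)
  qed
  ultimately have "AE u in lebesgue. cplx u \<in> \<Omega> \<longrightarrow> P (cplx u)"
    by (auto simp: eventually_ae_filter)
  then show ?thesis by (simp add: AE_completion_iff)
qed

lemma has_vector_derivative_quotient_tendsto: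
  fixes f :: "real \<Rightarrow> 'a::real_normed_vector"
  assumes "(f has_vector_derivative d) (at 0)"
  shows "((\<lambda>t. (f t - f 0) /\<^sub>R t) \<longlongrightarrow> d) (at 0)"
proof -
  have "((\<lambda>t. norm (f t - f 0 - t *\<^sub>R d) / norm t) \<longlongrightarrow> 0) (at 0)"
    using assms by (simp add: has_vector_derivative_def has_derivative_at)
  moreover have "norm (f t - f 0 - t *\<^sub>R d) / norm t = norm ((f t - f 0) /\<^sub>R t - d)" if "t \<noteq> 0" for t
  proof -
    have "(f t - f 0) /\<^sub>R t - d = (f t - f 0 - t *\<^sub>R d) /\<^sub>R t"
      using that by (simp add: scaleR_diff_right)
    then show ?thesis using that by (simp add: divide_inverse mult.commute)
  qed
  ultimately have "((\<lambda>t. norm ((f t - f 0) /\<^sub>R t - d)) \<longlongrightarrow> 0) (at 0)"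
    by (simp cong: Lim_cong_within)
  then show ?thesis
    by (rule LIM_zero_cancel[OF tendsto_norm_zero_cancel])
qed

lemma dbar_quotient_tendsto_0:
  assumes "has_dbar v 0 (cplx u)"
  shows "(\<lambda>n. dbar_quotient (v \<circ> cplx) n u) \<longlonglongrightarrow> 0"
proof -
  obtain dx dy where x: "has_partial_x v dx (cplx u)" and y: "has_partial_y v dy (cplx u)"
    and d: "0 = (1 / 2) * (dx + \<i> * dy)"
    using assms by (auto simp: has_dbar_def)
  have h: "filterlim (\<lambda>n. 1 / real (Suc n)) (at 0) sequentially"
  proof -
    have "(\<lambda>n. 1 / real (Suc n)) \<longlonglongrightarrow> 0"
      using LIMSEQ_inverse_real_of_nat by (simp add: inverse_eq_divide)
    then show ?thesis by (simp add: filterlim_at del: of_nat_Suc)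
  qed
  have "(\<lambda>n. real (Suc n) *\<^sub>R (v (cplx u + complex_of_real (1 / real (Suc n))) - v (cplx u))) \<longlonglongrightarrow> dx"
    using filterlim_compose[OF has_vector_derivative_quotient_tendsto[OF x[unfolded has_partial_x_def]] h]
    by (simp add: field_simps del: of_nat_Suc)
  moreover have "(\<lambda>n. real (Suc n) *\<^sub>R (v (cplx u + \<i> * complex_of_real (1 / real (Suc n))) - v (cplx u))) \<longlonglongrightarrow> dy"
    using filterlim_compose[OF has_vector_derivative_quotient_tendsto[OF y[unfolded has_partial_y_def]] h]
    by (simp add: field_simps del: of_nat_Suc)
  ultimately have "(\<lambda>n. real (Suc n) *\<^sub>R (v (cplx u + complex_of_real (1 / real (Suc n))) - v (cplx u))
      + \<i> * (real (Suc n) *\<^sub>R (v (cplx u + \<i> * complex_of_real (1 / real (Suc n))) - v (cplx u))))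
      \<longlonglongrightarrow> dx + \<i> * dy"
    by (intro tendsto_intros)
  moreover have "dx + \<i> * dy = 0" using d[symmetric] by simp
  moreover have "cplx (t, 0) = complex_of_real t" "cplx (0, t) = \<i> * complex_of_real t" for t
    by (auto simp: complex_eq_iff)
  ultimately show ?thesis
    by (simp only: dbar_quotient_def o_apply cplx_add)
qed

lemma locally_lipschitz_if_vector_derivative:
  fixes f :: "real \<Rightarrow> 'a::real_normed_vector"
  assumes "(f has_vector_derivative d) (at 0)"
  obtains \<delta> where "0 < \<delta>" "\<And>t. \<bar>t\<bar> < \<delta> \<Longrightarrow> norm (f t - f 0) \<le> (norm d + 1) * \<bar>t\<bar>"
proof -
  have "((\<lambda>t. norm ((f t - f 0) /\<^sub>R t)) \<longlongrightarrow> norm d) (at 0)"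
    by (intro tendsto_norm has_vector_derivative_quotient_tendsto assms)
  then have "eventually (\<lambda>t. norm ((f t - f 0) /\<^sub>R t) < norm d + 1) (at 0)"
    by (rule order_tendstoD) simp
  then obtain \<delta> where \<delta>: "0 < \<delta>" "\<And>t. t \<noteq> 0 \<Longrightarrow> \<bar>t\<bar> < \<delta> \<Longrightarrow> norm ((f t - f 0) /\<^sub>R t) < norm d + 1"
    by (auto simp: eventually_at dist_real_def)
  show thesis
  proof (rule that[OF \<delta>(1)])
    fix t :: real assume t: "\<bar>t\<bar> < \<delta>"
    show "norm (f t - f 0) \<le> (norm d + 1) * \<bar>t\<bar>"
    proof (cases "t = 0")
      case False
      then have "norm ((f t - f 0) /\<^sub>R t) * \<bar>t\<bar> \<le> (norm d + 1) * \<bar>t\<bar>"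
        using \<delta>(2)[OF False t] by (intro mult_right_mono) auto
      moreover have "norm ((f t - f 0) /\<^sub>R t) * \<bar>t\<bar> = norm (f t - f 0)"
        using False unfolding norm_scaleR by simp
      ultimately show ?thesis by linarith
    qed simp
  qed
qed

text \<open>
  Let \<open>U\<close> be the largest open set on which \<open>v\<close> is holomorphic, and suppose \<open>\<Omega> - U\<close> is nonempty.
  At a point where both partial derivatives exist, the increments of \<open>v\<close> along the axes are
  bounded by \<open>n\<close> times the step, for all steps below a threshold, for some \<open>n\<close>.  So a compact piece
  \<open>S\<close> of the bad set is the union of the closed sets \<open>A n\<close> where this holds with constant \<open>n\<close>, and of
  countably many points.  By Baire's theorem one of these contains a nonempty relatively open part
  of \<open>S\<close>.  If it is a single point, then that point is an isolated, hence removable,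
  singularity; if it is \<open>A n\<close>, the Lipschitz patch lemma applies.  Either way
  \<open>v\<close> is holomorphic near some point of \<open>\<Omega> - U\<close>, which is absurd.
\<close>

theorem looman_menchoff:
  assumes "open \<Omega>" and cont: "continuous_on \<Omega> v"
    and partials: "partials_exist_off_countable v \<Omega>"
    and ae: "AE z in lebesgue_on \<Omega>. has_dbar v 0 z"
  shows "v holomorphic_on \<Omega>"
proof -
  define \<W> where "\<W> = {W. open W \<and> W \<subseteq> \<Omega> \<and> v holomorphic_on W}"
  define U where "U = \<Union>\<W>"
  have "open U" unfolding U_def by (rule open_Union) (simp add: \<W>_def)
  moreover have "U \<subseteq> \<Omega>" unfolding U_def by (rule Union_least) (simp add: \<W>_def)
  ultimately have U: "open U" "U \<subseteq> \<Omega>" .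
  have vU: "v holomorphic_on U"
  proof -
    have "v holomorphic_on (\<Union>W\<in>\<W>. W)"
      by (rule holomorphic_on_UN_open) (auto simp: \<W>_def)
    then show ?thesis by (simp add: U_def)
  qed
  have UI: "W \<subseteq> U" if "open W" "W \<subseteq> \<Omega>" "v holomorphic_on W" for W
    unfolding U_def by (rule Union_upper) (use that in \<open>simp add: \<W>_def\<close>)
  have "\<Omega> \<subseteq> U"
  proof (rule ccontr)
    assume "\<not> \<Omega> \<subseteq> U"
    then obtain zs where zs: "zs \<in> \<Omega>" "zs \<notin> U" by blast
    obtain R where R: "0 < R" "cball zs R \<subseteq> \<Omega>"
      using \<open>open \<Omega>\<close> zs(1) open_contains_cball by blast
    define \<rho> where "\<rho> = R / 2"
    have \<rho>: "0 < \<rho>" "cball zs (2 * \<rho>) \<subseteq> \<Omega>" using R by (auto simp: \<rho>_def)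
    \<comment> \<open>The closure of an open piece of the bad set: any open set meeting \<open>S\<close> then meets the bad set inside the ball.\<close>
    define S where "S = closure ((\<Omega> - U) \<inter> ball zs \<rho>)"
    have "closed S" by (simp add: S_def)
    have Scb: "S \<subseteq> cball zs \<rho>"
      unfolding S_def by (rule closure_minimal) auto
    have S\<Omega>: "S \<subseteq> \<Omega>" using Scb \<rho> by (auto simp: subset_eq)
    have Sin: "z \<in> S" if "z \<in> \<Omega>" "z \<notin> U" "z \<in> ball zs \<rho>" for z
      unfolding S_def using that by (intro subsetD[OF closure_subset]) auto
    have shift: "z + w \<in> \<Omega>" if "z \<in> S" "norm w \<le> \<rho>" for z w
    proof -
      have "dist zs (z + w) \<le> dist zs z + dist z (z + w)" by (rule dist_triangle)
      also have "\<dots> \<le> \<rho> + \<rho>" using that Scb by (intro add_mono) (auto simp: dist_norm)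
      finally show ?thesis using \<rho>(2) by (auto simp: subset_eq)
    qed
    define A where "A n = {z \<in> S. \<forall>t. \<bar>t\<bar> \<le> \<rho> / real (Suc n) \<longrightarrow>
        norm (v (z + complex_of_real t) - v z) \<le> real n * \<bar>t\<bar> \<and>
        norm (v (z + \<i> * complex_of_real t) - v z) \<le> real n * \<bar>t\<bar>}" for n
    have small: "\<bar>t\<bar> \<le> \<rho>" if "\<bar>t\<bar> \<le> \<rho> / real (Suc n)" for t n
    proof -
      have "\<rho> / real (Suc n) \<le> \<rho> / 1" using \<rho> by (intro divide_left_mono) auto
      then show ?thesis using that by simp
    qed
    have A1: "norm (v (z + complex_of_real t) - v z) \<le> real n * \<bar>t\<bar>"
      and A2: "norm (v (z + \<i> * complex_of_real t) - v z) \<le> real n * \<bar>t\<bar>"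
      if "z \<in> A n" "\<bar>t\<bar> \<le> \<rho> / real (Suc n)" for z n t
      using that unfolding A_def by simp_all
    have closedA: "closed (A n)" for n
    proof -
      have cl: "closed {z \<in> S. norm (v (z + w) - v z) \<le> c}" if "norm w \<le> \<rho>" for w c
      proof -
        have "continuous_on S (\<lambda>z. norm (v (z + w) - v z))"
          using shift[OF _ that] S\<Omega>
          by (intro continuous_intros continuous_on_compose2[OF cont]) auto
        then show ?thesis
          by (intro continuous_on_closed_Collect_le \<open>closed S\<close> continuous_on_const)
      qed
      let ?I = "{t. \<bar>t\<bar> \<le> \<rho> / real (Suc n)}"
      have "A n = S \<inter> (\<Inter>t\<in>?I. {z \<in> S. norm (v (z + complex_of_real t) - v z) \<le> real n * \<bar>t\<bar>}
          \<inter> {z \<in> S. norm (v (z + \<i> * complex_of_real t) - v z) \<le> real n * \<bar>t\<bar>})"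
        (is "_ = ?R")
        by (auto simp: A_def)
      moreover have "closed ?R"
      proof (intro closed_Int \<open>closed S\<close> closed_INT ballI cl)
        fix t assume "t \<in> ?I"
        then show "norm (complex_of_real t) \<le> \<rho>" "norm (\<i> * complex_of_real t) \<le> \<rho>"
          using small by (simp_all add: norm_mult)
      qed
      ultimately show ?thesis by simp
    qed
    define N where "N = {z \<in> \<Omega>. \<not> ((\<exists>d. has_partial_x v d z) \<and> (\<exists>d. has_partial_y v d z))}"
    have "countable N" using partials by (simp add: N_def partials_exist_off_countable_def)
    have cover: "\<exists>n. z \<in> A n" if z: "z \<in> S" "z \<notin> N" for z
    proof -
      obtain dx dy where "has_partial_x v dx z" "has_partial_y v dy z"
        using z S\<Omega> unfolding N_def by blast
      note der = this[unfolded has_partial_x_def has_partial_y_def]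
      obtain \<delta>x where \<delta>x: "0 < \<delta>x" "\<And>t. \<bar>t\<bar> < \<delta>x \<Longrightarrow>
          norm (v (z + complex_of_real t) - v (z + complex_of_real 0)) \<le> (norm dx + 1) * \<bar>t\<bar>"
        by (rule locally_lipschitz_if_vector_derivative[OF der(1)]) (rule that)
      obtain \<delta>y where \<delta>y: "0 < \<delta>y" "\<And>t. \<bar>t\<bar> < \<delta>y \<Longrightarrow>
          norm (v (z + \<i> * complex_of_real t) - v (z + \<i> * complex_of_real 0)) \<le> (norm dy + 1) * \<bar>t\<bar>"
        by (rule locally_lipschitz_if_vector_derivative[OF der(2)]) (rule that)
      note x = \<delta>x[simplified] and y = \<delta>y[simplified]
      obtain n where n: "max (max (norm dx + 1) (norm dy + 1)) (\<rho> / min \<delta>x \<delta>y) < real n"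
        using reals_Archimedean2 by blast
      have "\<rho> / real (Suc n) < min \<delta>x \<delta>y"
      proof -
        have "\<rho> / min \<delta>x \<delta>y < real (Suc n)" using n by auto
        then have "\<rho> < real (Suc n) * min \<delta>x \<delta>y"
          using x(1) y(1) by (subst (asm) pos_divide_less_eq) auto
        then show ?thesis by (subst pos_divide_less_eq) (auto simp: mult.commute)
      qed
      then have "norm (v (z + complex_of_real t) - v z) \<le> real n * \<bar>t\<bar> \<and>
          norm (v (z + \<i> * complex_of_real t) - v z) \<le> real n * \<bar>t\<bar>" if "\<bar>t\<bar> \<le> \<rho> / real (Suc n)" for t
      proof -
        have t: "\<bar>t\<bar> < \<delta>x" "\<bar>t\<bar> < \<delta>y" using that \<open>\<rho> / real (Suc n) < min \<delta>x \<delta>y\<close> by auto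
        have "(norm dx + 1) * \<bar>t\<bar> \<le> real n * \<bar>t\<bar>" "(norm dy + 1) * \<bar>t\<bar> \<le> real n * \<bar>t\<bar>"
          using n by (auto intro!: mult_right_mono)
        with x(2)[OF t(1)] y(2)[OF t(2)] show ?thesis by linarith
      qed
      then show ?thesis using z by (auto simp: A_def)
    qed
    define \<C> where "\<C> = range A \<union> (\<lambda>z. {z}) ` (N \<inter> S)"
    have "\<exists>C\<in>\<C>. \<not> S \<subseteq> closure (S - C)"
    proof (rule ccontr)
      assume dense: "\<not> (\<exists>C\<in>\<C>. \<not> S \<subseteq> closure (S - C))"
      have "S \<subseteq> closure (\<Inter>((\<lambda>C. S - C) ` \<C>))"
      proof (rule Baire[OF \<open>closed S\<close>])
        show "countable ((\<lambda>C. S - C) ` \<C>)" using \<open>countable N\<close> by (simp add: \<C>_def)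
        fix T assume "T \<in> (\<lambda>C. S - C) ` \<C>"
        then obtain C where C: "C \<in> \<C>" "T = S - C" by blast
        then have "closed C" using closedA by (auto simp: \<C>_def)
        then have "openin (top_of_set S) T"
          unfolding C(2) by (simp add: Diff_eq open_Compl openin_open_Int)
        with dense C show "openin (top_of_set S) T \<and> S \<subseteq> closure T" by auto
      qed
      moreover have "\<Inter>((\<lambda>C. S - C) ` \<C>) = {}"
      proof -
        have "A 0 \<in> \<C>" by (simp add: \<C>_def)
        moreover have "\<exists>C\<in>\<C>. z \<in> C" if "z \<in> S" for z
          using cover[OF that] that by (cases "z \<in> N") (auto simp: \<C>_def)
        ultimately show ?thesis by blast
      qed
      moreover have "zs \<in> S" using Sin zs \<rho> by auto
      ultimately show False by auto
    qed
    then obtain C s where C: "C \<in> \<C>" and s: "s \<in> S" "s \<notin> closure (S - C)" by blast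
    define V where "V = ball zs \<rho> - closure (S - C)"
    have "open V" by (auto simp: V_def open_Diff)
    have V\<Omega>: "V \<subseteq> \<Omega>" using \<rho> by (auto simp: V_def subset_eq)
    have VS: "V \<inter> S \<subseteq> C" using closure_subset[of "S - C"] by (auto simp: V_def)
    have "- closure (S - C) \<inter> ((\<Omega> - U) \<inter> ball zs \<rho>) \<noteq> {}"
    proof -
      have "open (- closure (S - C))" by auto
      from open_Int_closure_eq_empty[OF this, of "(\<Omega> - U) \<inter> ball zs \<rho>", folded S_def] s
      show ?thesis by blast
    qed
    then obtain e where "e \<in> - closure (S - C) \<inter> ((\<Omega> - U) \<inter> ball zs \<rho>)" by blast
    then have e: "e \<in> V" "e \<in> \<Omega>" "e \<notin> U" by (simp_all add: V_def)
    have eS: "e \<in> S" using e Sin by (auto simp: V_def)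
    have VU: "z \<in> U" if "z \<in> V" "z \<notin> S" for z
    proof (rule ccontr)
      assume "z \<notin> U"
      moreover have "z \<in> \<Omega>" "z \<in> ball zs \<rho>" using that V\<Omega> by (auto simp: V_def)
      ultimately show False using Sin \<open>z \<notin> S\<close> by blast
    qed
    from C consider n where "C = A n" | z where "C = {z}" by (auto simp: \<C>_def)
    then show False
    proof cases
      case 2
      then have "V - {e} \<subseteq> U" using VS eS e VU by auto
      then have "v holomorphic_on V"
        using no_isolated_singularity[of V v "{e}"] cont V\<Omega> \<open>open V\<close> vU
        by (meson continuous_on_subset finite.emptyI finite_insert holomorphic_on_subset)
      then show False using UI[OF \<open>open V\<close> V\<Omega>] e by auto
    next
      case 1
      obtain r0 where r0: "0 < r0" "ball e r0 \<subseteq> V" using \<open>open V\<close> e open_contains_ball by blast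
      define r where "r = min r0 (\<rho> / real (Suc n)) / 2"
      have "2 * r = min r0 (\<rho> / real (Suc n))" by (simp add: r_def)
      then have "2 * r \<le> \<rho> / real (Suc n)" by (metis min.cobounded2)
      moreover have "0 < r" "ball e r \<subseteq> V" using r0 \<rho> by (auto simp: r_def)
      ultimately have r: "0 < r" "ball e r \<subseteq> V" "2 * r \<le> \<rho> / real (Suc n)" by blast+
      have "v holomorphic_on ball e r"
      proof (rule holomorphic_on_if_axis_lipschitz[OF open_ball \<open>closed S\<close>])
        show "continuous_on (ball e r) v"
          using cont V\<Omega> r by (meson continuous_on_subset)
        show "v holomorphic_on ball e r - S"
          using vU by (rule holomorphic_on_subset) (use VU r in auto)
        show "norm (v w - v z) \<le> real n * norm (w - z)"
          if z: "z \<in> S \<inter> ball e r" and w: "w \<in> ball e r" and axis: "Re w = Re z \<or> Im w = Im z" for z w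
        proof -
          have zA: "z \<in> A n" using z r VS 1 by auto
          have "dist w z \<le> dist e w + dist e z" by (metis dist_commute dist_triangle)
          then have d: "norm (w - z) \<le> \<rho> / real (Suc n)"
            using z w r(3) by (auto simp: dist_norm)
          from axis show ?thesis
          proof
            assume "Re w = Re z"
            then have eq: "w = z + \<i> * complex_of_real (Im w - Im z)" by (auto simp: complex_eq_iff)
            then have nrm: "norm (w - z) = \<bar>Im w - Im z\<bar>"
              by (metis add_diff_cancel_left' norm_ii mult_1 norm_mult norm_of_real)
            have "norm (v (z + \<i> * complex_of_real (Im w - Im z)) - v z) \<le> real n * \<bar>Im w - Im z\<bar>"
              by (rule A2[OF zA]) (use d nrm in simp)
            then show ?thesis by (simp only: eq[symmetric] nrm)
          next
            assume "Im w = Im z"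
            then have eq: "w = z + complex_of_real (Re w - Re z)" by (auto simp: complex_eq_iff)
            then have nrm: "norm (w - z) = \<bar>Re w - Re z\<bar>"
              by (metis add_diff_cancel_left' norm_of_real)
            have "norm (v (z + complex_of_real (Re w - Re z)) - v z) \<le> real n * \<bar>Re w - Re z\<bar>"
              by (rule A1[OF zA]) (use d nrm in simp)
            then show ?thesis by (simp only: eq[symmetric] nrm)
          qed
        qed
        show "AE u in lborel. cplx u \<in> S \<inter> ball e r \<longrightarrow> (\<lambda>n. dbar_quotient (v \<circ> cplx) n u) \<longlonglongrightarrow> 0"
          using AE_cplx_if_AE_lebesgue_on[OF \<open>open \<Omega>\<close> ae]
        proof eventually_elim
          case (elim u)
          then show ?case using S\<Omega> dbar_quotient_tendsto_0[of v u] by auto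
        qed
      qed
      then have "ball e r \<subseteq> U" using r V\<Omega> by (intro UI) auto
      then have "e \<in> U" using r by auto
      then show False using e by simp
    qed
  qed
  then show ?thesis using vU holomorphic_on_subset by blast
qed

section \<open>Primitives of functions with a pole\<close>

text \<open>
  Move radially from \<open>w\<close> to the circle of radius \<open>\<rho>\<close>: along this segment the distance from \<open>w0\<close>
  never drops below that of \<open>w\<close>, so the derivative is bounded by its bound at \<open>w\<close>.
\<close>

lemma norm_antiderivative_le:
  fixes F :: "complex \<Rightarrow> complex"
  assumes hol: "F holomorphic_on ball w0 r - {w0}"
    and "0 < \<rho>" "\<rho> < r" "0 \<le> B"
    and bound: "\<And>w. w \<in> cball w0 \<rho> - {w0} \<Longrightarrow> norm (deriv F w) \<le> B / norm (w - w0) ^ n"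
  obtains M where "\<And>w. w \<in> cball w0 \<rho> - {w0} \<Longrightarrow> norm (F w) \<le> M + B * \<rho> / norm (w - w0) ^ n"
proof -
  have op: "open (ball w0 r - {w0})" by auto
  have "continuous_on (sphere w0 \<rho>) F"
    by (rule continuous_on_subset[OF holomorphic_on_imp_continuous_on[OF hol]]) (use assms in \<open>auto simp: dist_norm\<close>)
  then have "bounded (F ` sphere w0 \<rho>)"
    by (intro compact_imp_bounded compact_continuous_image compact_sphere)
  then obtain M where "\<forall>y\<in>F ` sphere w0 \<rho>. norm y \<le> M"
    unfolding bounded_iff by blast
  then have M: "norm (F w) \<le> M" if "w \<in> sphere w0 \<rho>" for w
    using that by blast
  have "norm (F w) \<le> M + B * \<rho> / norm (w - w0) ^ n" if w: "w \<in> cball w0 \<rho> - {w0}" for w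
  proof -
    define d where "d = norm (w - w0)"
    have d: "0 < d" "d \<le> \<rho>" using w by (auto simp: d_def dist_norm norm_minus_commute)
    define w' where "w' = w0 + complex_of_real (\<rho> / d) * (w - w0)"
    have w': "w' \<in> sphere w0 \<rho>"
      using d \<open>0 < \<rho>\<close> by (simp add: w'_def dist_norm norm_mult norm_divide d_def[symmetric])
    have seg: "d \<le> norm (v - w0) \<and> norm (v - w0) \<le> \<rho>" if v: "v \<in> closed_segment w w'" for v
    proof -
      obtain x where x: "0 \<le> x" "x \<le> 1" "v = (1 - x) *\<^sub>R w + x *\<^sub>R w'"
        using v by (auto simp: closed_segment_def)
      have "v - w0 = complex_of_real ((1 - x) + x * (\<rho> / d)) * (w - w0)"
        by (simp add: x(3) w'_def scaleR_conv_of_real algebra_simps)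
      then have "norm (v - w0) = \<bar>(1 - x) + x * (\<rho> / d)\<bar> * d"
        by (simp only: norm_mult norm_of_real d_def)
      also have "\<bar>(1 - x) + x * (\<rho> / d)\<bar> = (1 - x) + x * (\<rho> / d)"
        using x d \<open>0 < \<rho>\<close> by (intro abs_of_nonneg add_nonneg_nonneg) auto
      also have "\<dots> * d = (1 - x) * d + x * \<rho>" using d by (simp add: field_simps)
      finally have "norm (v - w0) = (1 - x) * d + x * \<rho>" .
      moreover have "(1 - x) * d + x * d \<le> (1 - x) * d + x * \<rho>" "(1 - x) * d + x * \<rho> \<le> (1 - x) * \<rho> + x * \<rho>"
        using x d by (intro add_mono mult_left_mono; simp)+
      ultimately show ?thesis by (simp add: algebra_simps)
    qed
    have le: "norm (F w - F w') \<le> (B / d ^ n) * norm (w - w')"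
    proof (rule field_differentiable_bound[where S = "closed_segment w w'" and f' = "deriv F"])
      fix v assume v: "v \<in> closed_segment w w'"
      have vin: "v \<in> cball w0 \<rho> - {w0}" using seg[OF v] d by (auto simp: dist_norm norm_minus_commute)
      then have "v \<in> ball w0 r - {w0}" using \<open>\<rho> < r\<close> by auto
      then show "(F has_field_derivative deriv F v) (at v within closed_segment w w')"
        by (rule has_field_derivative_at_within[OF holomorphic_derivI[OF hol op]])
      have "norm (deriv F v) \<le> B / norm (v - w0) ^ n" by (rule bound[OF vin])
      also have "\<dots> \<le> B / d ^ n"
        using seg[OF v] d \<open>0 \<le> B\<close> by (intro divide_left_mono power_mono mult_pos_pos zero_less_power) auto
      finally show "norm (deriv F v) \<le> B / d ^ n" .
    qed (auto simp: convex_closed_segment)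
    have "norm (w - w') \<le> \<rho>"
    proof -
      have "w' - w = complex_of_real (\<rho> / d - 1) * (w - w0)" by (simp add: w'_def algebra_simps)
      then have "norm (w' - w) = \<bar>\<rho> / d - 1\<bar> * d" by (simp only: norm_mult norm_of_real d_def)
      also have "\<bar>\<rho> / d - 1\<bar> = \<rho> / d - 1" using d by (intro abs_of_nonneg) (simp add: field_simps)
      also have "\<dots> * d \<le> \<rho>" using d by (simp add: field_simps)
      finally show ?thesis by (simp add: norm_minus_commute)
    qed
    with d \<open>0 \<le> B\<close> have "norm (F w - F w') \<le> (B / d ^ n) * \<rho>"
      by (intro order.trans[OF le] mult_left_mono) auto
    moreover have "norm (F w) \<le> norm (F w') + norm (F w - F w')"
      by (metis add.commute diff_add_cancel norm_triangle_ineq)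
    ultimately show ?thesis using M[OF w'] by (simp add: d_def)
  qed
  then show thesis by (rule that)
qed

text \<open>
  The function \<open>f\<close> extends holomorphically to \<open>w0\<close> with a zero of finite order, so \<open>F' = 1 / f\<close> and
  with it \<open>F\<close> grow at most like a power of \<open>1 / norm (w - w0)\<close>, and \<open>F\<close> has no essential singularity.
  A finite limit is impossible too: then \<open>F\<close> would extend holomorphically, and \<open>f * F'\<close>, which is
  identically one off \<open>w0\<close>, would tend to \<open>f w0 * F' w0 = 0\<close>.
\<close>

lemma is_pole_antiderivative:
  fixes f F :: "complex \<Rightarrow> complex"
  assumes "0 < r" and contf: "continuous_on (ball w0 r) f" and f0: "f w0 = 0"
    and hol: "F holomorphic_on ball w0 r - {w0}"
    and deriv: "\<And>w. w \<in> ball w0 r - {w0} \<Longrightarrow> f w \<noteq> 0 \<and> deriv F w = 1 / f w"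
  shows "is_pole F w0"
proof -
  let ?D = "ball w0 r"
  have op: "open (?D - {w0})" by auto
  have "(\<lambda>w. inverse (deriv F w)) holomorphic_on ?D - {w0}"
    by (intro holomorphic_on_inverse holomorphic_deriv hol op) (use deriv in auto)
  then have "f holomorphic_on ?D - {w0}"
    by (rule holomorphic_transform) (use deriv in auto)
  then have holf: "f holomorphic_on ?D"
    by (intro no_isolated_singularity[OF contf, of "{w0}"]) auto
  have nonconst: "\<not> f constant_on ?D"
  proof
    assume "f constant_on ?D"
    then have "f w = 0" if "w \<in> ?D" for w
      using that f0 \<open>0 < r\<close> by (metis centre_in_ball constant_on_def)
    moreover have "w0 + of_real (r / 2) \<in> ?D - {w0}" using \<open>0 < r\<close> by (auto simp: dist_norm)
    ultimately show False using deriv by blast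
  qed
  obtain g r1 n where g: "0 < n" "0 < r1" "ball w0 r1 \<subseteq> ?D" "g holomorphic_on ball w0 r1"
      "\<And>w. w \<in> ball w0 r1 \<Longrightarrow> f w = (w - w0) ^ n * g w" "\<And>w. w \<in> ball w0 r1 \<Longrightarrow> g w \<noteq> 0"
    using holomorphic_factor_zero_nonconstant[OF holf open_ball connected_ball _ f0 nonconst] \<open>0 < r\<close>
    by (metis centre_in_ball)
  define \<rho> where "\<rho> = min r1 r / 2"
  have \<rho>: "0 < \<rho>" "\<rho> < r1" "\<rho> < r" using g \<open>0 < r\<close> by (auto simp: \<rho>_def)
  have sub: "cball w0 \<rho> \<subseteq> ball w0 r1" using \<rho> by auto
  have "continuous_on (cball w0 \<rho>) (\<lambda>w. inverse (g w))"
    using g sub by (intro continuous_intros continuous_on_subset[OF holomorphic_on_imp_continuous_on]) auto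
  then have "bounded ((\<lambda>w. inverse (g w)) ` cball w0 \<rho>)"
    by (intro compact_imp_bounded compact_continuous_image compact_cball)
  then obtain B where B: "0 < B" "\<And>w. w \<in> cball w0 \<rho> \<Longrightarrow> norm (inverse (g w)) \<le> B"
    by (auto simp: bounded_pos)
  have "norm (deriv F w) \<le> B / norm (w - w0) ^ n" if w: "w \<in> cball w0 \<rho> - {w0}" for w
  proof -
    have w': "w \<in> ball w0 r1" "w \<in> ?D - {w0}" using w sub \<rho> by auto
    have "deriv F w = inverse (g w) / (w - w0) ^ n"
      using deriv[OF w'(2)] g(5)[OF w'(1)] by (simp add: field_simps)
    then have "norm (deriv F w) = norm (inverse (g w)) / norm (w - w0) ^ n"
      by (simp add: norm_divide norm_power)
    then show ?thesis using B(2)[of w] w by (simp add: divide_right_mono)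
  qed
  from norm_antiderivative_le[OF hol \<rho>(1,3) less_imp_le[OF B(1)] this]
  obtain M where M: "\<And>w. w \<in> cball w0 \<rho> - {w0} \<Longrightarrow> norm (F w) \<le> M + B * \<rho> / norm (w - w0) ^ n" by blast
  \<comment> \<open>One power more than the bound on \<open>F\<close> requires, so that \<open>G\<close> has the limit zero rather than just being bounded.\<close>
  define G where "G w = (w - w0) ^ Suc n * F w" for w
  have bd: "norm (G w) \<le> (\<bar>M\<bar> * \<rho> ^ n + B * \<rho>) * norm (w - w0)" if w: "w \<in> cball w0 \<rho> - {w0}" for w
  proof -
    define d where "d = norm (w - w0)"
    have d: "0 < d" "d \<le> \<rho>" using w by (auto simp: d_def dist_norm norm_minus_commute)
    have "norm (G w) = d ^ Suc n * norm (F w)" by (simp add: G_def norm_mult norm_power d_def)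
    also have "\<dots> \<le> d ^ Suc n * (M + B * \<rho> / d ^ n)"
      using M[OF w] d by (intro mult_left_mono) (auto simp: d_def)
    also have "\<dots> = (M * d ^ n + B * \<rho>) * d"
      using d by (simp add: field_simps)
    also have "\<dots> \<le> (\<bar>M\<bar> * \<rho> ^ n + B * \<rho>) * d"
      using d by (intro mult_right_mono add_right_mono mult_mono power_mono) auto
    finally show ?thesis by (simp add: d_def)
  qed
  have near: "eventually (\<lambda>w. w \<in> cball w0 \<rho> - {w0}) (at w0)"
    using \<rho> by (auto simp: eventually_at dist_commute intro!: exI[of _ \<rho>])
  have "G \<midarrow>w0\<rightarrow> 0"
  proof (rule Lim_null_comparison)
    show "eventually (\<lambda>w. norm (G w) \<le> (\<bar>M\<bar> * \<rho> ^ n + B * \<rho>) * norm (w - w0)) (at w0)"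
      using near by eventually_elim (rule bd)
    show "((\<lambda>w. (\<bar>M\<bar> * \<rho> ^ n + B * \<rho>) * norm (w - w0)) \<longlongrightarrow> 0) (at w0)"
      by (auto intro!: tendsto_eq_intros)
  qed
  then have "not_essential G w0" by auto
  moreover have "isolated_singularity_at G w0"
    unfolding G_def by (rule isolated_singularity_at_holomorphic[of _ ?D])
      (use \<open>0 < r\<close> in \<open>auto intro!: holomorphic_intros hol\<close>)
  moreover have "(\<lambda>w. (w - w0) ^ Suc n) holomorphic_on UNIV" by (intro holomorphic_intros)
  then have "not_essential (\<lambda>w. (w - w0) ^ Suc n) w0" "isolated_singularity_at (\<lambda>w. (w - w0) ^ Suc n) w0"
    by (auto intro: not_essential_holomorphic isolated_singularity_at_holomorphic holomorphic_on_subset)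
  ultimately have "not_essential (\<lambda>w. G w / (w - w0) ^ Suc n) w0"
    by (intro not_essential_divide)
  then have "not_essential F w0"
  proof (rule not_essential_transform)
    show "eventually (\<lambda>w. G w / (w - w0) ^ Suc n = F w) (at w0)"
      using near by eventually_elim (auto simp: G_def)
  qed
  moreover have "\<not> F \<midarrow>w0\<rightarrow> x" for x
  proof
    assume lim: "F \<midarrow>w0\<rightarrow> x"
    define F1 where "F1 = F(w0 := x)"
    have holF1: "F1 holomorphic_on ?D - {w0}"
      by (rule holomorphic_transform[OF hol]) (auto simp: F1_def)
    have limF1: "(F1 \<longlongrightarrow> F1 w0) (at w0 within ?D)"
    proof -
      have "F1 \<midarrow>w0\<rightarrow> x"
        using lim by (rule Lim_transform_eventually) (simp add: F1_def eventually_at_filter)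
      then have "F1 \<midarrow>w0\<rightarrow> F1 w0" by (simp add: F1_def)
      then show ?thesis by (rule tendsto_within_subset) simp
    qed
    have F1: "F1 holomorphic_on ?D"
    proof (rule no_isolated_singularity'[where K = "{w0}"])
      show "(F1 \<longlongrightarrow> F1 z) (at z within ?D)" if "z \<in> {w0}" for z
        using that limF1 by simp
    qed (use holF1 in auto)
    have "continuous_on ?D (\<lambda>w. f w * deriv F1 w)"
      by (intro continuous_on_mult contf holomorphic_on_imp_continuous_on holomorphic_deriv F1 open_ball)
    then have "isCont (\<lambda>w. f w * deriv F1 w) w0"
      using \<open>0 < r\<close> by (simp add: continuous_on_eq_continuous_at)
    then have "((\<lambda>w. f w * deriv F1 w) \<longlongrightarrow> f w0 * deriv F1 w0) (at w0)"
      unfolding isCont_def .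
    moreover have "eventually (\<lambda>w. f w * deriv F1 w = 1) (at w0)"
      using near
    proof eventually_elim
      case (elim w)
      then have w: "w \<in> ?D - {w0}" using \<rho> by auto
      have "deriv F1 w = deriv F w"
        by (rule complex_derivative_transform_within_open[OF holF1 hol op w]) (auto simp: F1_def)
      then show ?case using deriv[OF w] by simp
    qed
    ultimately have "((\<lambda>w. 1) \<longlongrightarrow> f w0 * deriv F1 w0) (at w0)"
      by (rule Lim_transform_eventually)
    then have "f w0 * deriv F1 w0 = 1"
      using LIM_const_eq by metis
    then show False using f0 by simp
  qed
  ultimately show ?thesis by (auto simp: not_essential_def)
qed

section \<open>The transformed equation\<close>

text \<open>
  The expression is \<open>1 / (1 / \<kappa>(\<mu>) - \<gamma>)\<close>, arranged so that zeros of \<open>\<kappa>\<close> are harmless.  The terms with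
  \<open>\<gamma> \<kappa> \<kappa>'\<close> cancel, which is why \<open>\<kappa>'\<close> and \<open>\<kappa>\<^sup>2\<close> are the only coefficients left.
\<close>

lemma has_vector_derivative_reciprocal_combination:
  fixes \<kappa> :: "complex \<Rightarrow> complex" and \<mu> \<gamma> :: "real \<Rightarrow> complex"
  assumes \<mu>: "(\<mu> has_vector_derivative d\<mu>) (at 0)" and \<gamma>: "(\<gamma> has_vector_derivative d\<gamma>) (at 0)"
    and \<kappa>: "(\<kappa> has_field_derivative \<kappa>') (at (\<mu> 0))"
    and nz: "1 - \<gamma> 0 * \<kappa> (\<mu> 0) \<noteq> 0"
  shows "((\<lambda>t. \<kappa> (\<mu> t) / (1 - \<gamma> t * \<kappa> (\<mu> t))) has_vector_derivative
    (\<kappa>' * d\<mu> + \<kappa> (\<mu> 0) ^ 2 * d\<gamma>) / (1 - \<gamma> 0 * \<kappa> (\<mu> 0)) ^ 2) (at 0)"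
proof -
  have k: "((\<lambda>t. \<kappa> (\<mu> t)) has_vector_derivative d\<mu> * \<kappa>') (at 0)"
    using field_vector_diff_chain_at[OF \<mu> \<kappa>] by (simp add: o_def)
  have m: "((\<lambda>t. 1 - \<gamma> t * \<kappa> (\<mu> t)) has_vector_derivative 0 - (\<gamma> 0 * (d\<mu> * \<kappa>') + d\<gamma> * \<kappa> (\<mu> 0))) (at 0)"
    by (intro has_vector_derivative_diff has_vector_derivative_const has_vector_derivative_mult \<gamma> k)
  have "((\<lambda>t. inverse (1 - \<gamma> t * \<kappa> (\<mu> t))) has_vector_derivative
      (0 - (\<gamma> 0 * (d\<mu> * \<kappa>') + d\<gamma> * \<kappa> (\<mu> 0))) * - (inverse (1 - \<gamma> 0 * \<kappa> (\<mu> 0)) ^ 2)) (at 0)"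
    using field_vector_diff_chain_at[OF m DERIV_inverse[OF nz]]
    by (simp add: o_def power2_eq_square numeral_2_eq_2)
  from has_vector_derivative_mult[OF k this]
  have "((\<lambda>t. \<kappa> (\<mu> t) / (1 - \<gamma> t * \<kappa> (\<mu> t))) has_vector_derivative
      \<kappa> (\<mu> 0) * ((0 - (\<gamma> 0 * (d\<mu> * \<kappa>') + d\<gamma> * \<kappa> (\<mu> 0))) * - (inverse (1 - \<gamma> 0 * \<kappa> (\<mu> 0)) ^ 2))
       + d\<mu> * \<kappa>' * inverse (1 - \<gamma> 0 * \<kappa> (\<mu> 0))) (at 0)"
    by (simp add: divide_inverse)
  moreover have "\<kappa> (\<mu> 0) * ((0 - (\<gamma> 0 * (d\<mu> * \<kappa>') + d\<gamma> * \<kappa> (\<mu> 0))) * - (inverse (1 - \<gamma> 0 * \<kappa> (\<mu> 0)) ^ 2))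
       + d\<mu> * \<kappa>' * inverse (1 - \<gamma> 0 * \<kappa> (\<mu> 0)) =
      (\<kappa>' * d\<mu> + \<kappa> (\<mu> 0) ^ 2 * d\<gamma>) / (1 - \<gamma> 0 * \<kappa> (\<mu> 0)) ^ 2"
  proof -
    have "\<kappa>0 * ((0 - (g * (d\<mu> * \<kappa>') + d\<gamma> * \<kappa>0)) * - (inverse D ^ 2)) + d\<mu> * \<kappa>' * inverse D =
        (\<kappa>' * d\<mu> + \<kappa>0 ^ 2 * d\<gamma>) / D ^ 2" if "D = 1 - g * \<kappa>0" "D \<noteq> 0" for D g \<kappa>0
    proof -
      have flip: "\<kappa>0 * ((0 - X) * - Y) = \<kappa>0 * X * Y" for X Y :: complex by simp
      have "d\<mu> * \<kappa>' * inverse D = (d\<mu> * \<kappa>' * D) / D ^ 2"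
        using that by (simp add: power2_eq_square divide_inverse)
      moreover have "inverse D ^ 2 = 1 / D ^ 2" by (simp add: power_inverse divide_inverse)
      ultimately have "\<kappa>0 * ((0 - (g * (d\<mu> * \<kappa>') + d\<gamma> * \<kappa>0)) * - (inverse D ^ 2)) + d\<mu> * \<kappa>' * inverse D =
          (\<kappa>0 * (g * (d\<mu> * \<kappa>') + d\<gamma> * \<kappa>0) + d\<mu> * \<kappa>' * D) / D ^ 2"
        by (simp only: flip) (simp add: add_divide_distrib)
      also have "\<kappa>0 * (g * (d\<mu> * \<kappa>') + d\<gamma> * \<kappa>0) + d\<mu> * \<kappa>' * D = \<kappa>' * d\<mu> + \<kappa>0 ^ 2 * d\<gamma>"
        by (simp add: that(1) algebra_simps power2_eq_square)
      finally show ?thesis .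
    qed
    from this[OF refl nz] show ?thesis .
  qed
  ultimately show ?thesis by simp
qed

lemma has_partial_reciprocal_combination:
  assumes \<kappa>: "(\<kappa> has_field_derivative \<kappa>') (at (u z))" and nz: "1 - G z * \<kappa> (u z) \<noteq> 0"
  shows "has_partial_x u a z \<Longrightarrow> has_partial_x G b z \<Longrightarrow>
      has_partial_x (\<lambda>z. \<kappa> (u z) / (1 - G z * \<kappa> (u z))) ((\<kappa>' * a + \<kappa> (u z) ^ 2 * b) / (1 - G z * \<kappa> (u z)) ^ 2) z"
    and "has_partial_y u a z \<Longrightarrow> has_partial_y G b z \<Longrightarrow>
      has_partial_y (\<lambda>z. \<kappa> (u z) / (1 - G z * \<kappa> (u z))) ((\<kappa>' * a + \<kappa> (u z) ^ 2 * b) / (1 - G z * \<kappa> (u z)) ^ 2) z"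
proof -
  assume "has_partial_x u a z" "has_partial_x G b z"
  from has_vector_derivative_reciprocal_combination[OF this[unfolded has_partial_x_def], of \<kappa> \<kappa>'] \<kappa> nz
  show "has_partial_x (\<lambda>z. \<kappa> (u z) / (1 - G z * \<kappa> (u z))) ((\<kappa>' * a + \<kappa> (u z) ^ 2 * b) / (1 - G z * \<kappa> (u z)) ^ 2) z"
    by (simp add: has_partial_x_def)
next
  assume "has_partial_y u a z" "has_partial_y G b z"
  from has_vector_derivative_reciprocal_combination[OF this[unfolded has_partial_y_def], of \<kappa> \<kappa>'] \<kappa> nz
  show "has_partial_y (\<lambda>z. \<kappa> (u z) / (1 - G z * \<kappa> (u z))) ((\<kappa>' * a + \<kappa> (u z) ^ 2 * b) / (1 - G z * \<kappa> (u z)) ^ 2) z"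
    by (simp add: has_partial_y_def)
qed

lemma has_dbar_reciprocal_combination:
  assumes \<kappa>: "(\<kappa> has_field_derivative \<kappa>') (at (u z))" and nz: "1 - G z * \<kappa> (u z) \<noteq> 0"
    and u: "has_dbar u a z" and G: "has_dbar G b z"
  shows "has_dbar (\<lambda>z. \<kappa> (u z) / (1 - G z * \<kappa> (u z)))
    ((\<kappa>' * a + \<kappa> (u z) ^ 2 * b) / (1 - G z * \<kappa> (u z)) ^ 2) z"
proof -
  obtain ux uy where u': "has_partial_x u ux z" "has_partial_y u uy z" "a = (1 / 2) * (ux + \<i> * uy)"
    using u unfolding has_dbar_def by blast
  obtain Gx Gy where G': "has_partial_x G Gx z" "has_partial_y G Gy z" "b = (1 / 2) * (Gx + \<i> * Gy)"
    using G unfolding has_dbar_def by blast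
  let ?D = "(1 - G z * \<kappa> (u z)) ^ 2"
  have "(\<kappa>' * a + \<kappa> (u z) ^ 2 * b) / ?D =
      (1 / 2) * ((\<kappa>' * ux + \<kappa> (u z) ^ 2 * Gx) / ?D + \<i> * ((\<kappa>' * uy + \<kappa> (u z) ^ 2 * Gy) / ?D))"
    unfolding u'(3) G'(3) by (simp add: add_divide_distrib algebra_simps)
  then show ?thesis
    using has_partial_reciprocal_combination(1)[of \<kappa> \<kappa>' u z G, OF \<kappa> nz u'(1) G'(1)]
      has_partial_reciprocal_combination(2)[of \<kappa> \<kappa>' u z G, OF \<kappa> nz u'(2) G'(2)]
    unfolding has_dbar_def by blast
qed

lemma AE_lebesgue_on_open_subset:
  assumes "AE z in lebesgue_on B. P z" "open A" "open B" "A \<subseteq> B"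
  shows "AE z in lebesgue_on A. P z"
proof -
  have "AE z in lebesgue. z \<in> B \<longrightarrow> P z"
    using assms by (simp add: AE_restrict_space_iff borel_open)
  then have "AE z in lebesgue. z \<in> A \<longrightarrow> P z"
    by eventually_elim (use \<open>A \<subseteq> B\<close> in blast)
  then show ?thesis
    using \<open>open A\<close> by (simp add: AE_restrict_space_iff borel_open)
qed

text \<open>
  With \<open>\<kappa>' f = -\<kappa>\<^sup>2\<close> the d-bar derivative of the combination is \<open>(-\<kappa>\<^sup>2 g + \<kappa>\<^sup>2 g) / (1 - G \<kappa>)\<^sup>2\<close>, which is
  zero.  As \<open>\<kappa> w0 = 0\<close>, the denominator is close to one near \<open>z1\<close>.
\<close>

lemma holomorphic_reciprocal_combination:
  fixes f g u G \<kappa> :: "complex \<Rightarrow> complex"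
  assumes "open \<Omega>" "z1 \<in> \<Omega>" "u z1 = w0"
    and contu: "continuous_on \<Omega> u" and contG: "continuous_on \<Omega> G"
    and partu: "partials_exist_off_countable u \<Omega>" and partG: "partials_exist_off_countable G \<Omega>"
    and dbaru: "AE z in lebesgue_on \<Omega>. has_dbar u (f (u z) * g z) z"
    and dbarG: "AE z in lebesgue_on \<Omega>. has_dbar G (g z) z"
    and "0 < \<rho>" and \<kappa>: "\<kappa> holomorphic_on ball w0 \<rho>" "\<kappa> w0 = 0"
    and ode: "\<And>w. w \<in> ball w0 \<rho> \<Longrightarrow> deriv \<kappa> w * f w = - (\<kappa> w ^ 2)"
  obtains \<delta> where "0 < \<delta>" "ball z1 \<delta> \<subseteq> \<Omega>"
    "\<And>z. z \<in> ball z1 \<delta> \<Longrightarrow> u z \<in> ball w0 \<rho> \<and> 1 - G z * \<kappa> (u z) \<noteq> 0"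
    "(\<lambda>z. \<kappa> (u z) / (1 - G z * \<kappa> (u z))) holomorphic_on ball z1 \<delta>"
proof -
  define W where "W = \<Omega> \<inter> u -` ball w0 \<rho>"
  have "open W" unfolding W_def by (rule continuous_open_preimage[OF contu \<open>open \<Omega>\<close> open_ball])
  have W\<Omega>: "W \<subseteq> \<Omega>" by (auto simp: W_def)
  have contk: "continuous_on W (\<lambda>z. \<kappa> (u z))"
    by (rule continuous_on_compose2[OF holomorphic_on_imp_continuous_on[OF \<kappa>(1)]])
      (auto simp: W_def intro: continuous_on_subset[OF contu])
  have contGk: "continuous_on W (\<lambda>z. G z * \<kappa> (u z))"
    by (intro continuous_intros contk continuous_on_subset[OF contG W\<Omega>])
  define X where "X = W \<inter> (\<lambda>z. G z * \<kappa> (u z)) -` ball 0 1"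
  have "open X" unfolding X_def by (rule continuous_open_preimage[OF contGk \<open>open W\<close> open_ball])
  moreover have "z1 \<in> X" using assms by (simp add: X_def W_def)
  ultimately obtain \<delta> where \<delta>: "0 < \<delta>" "ball z1 \<delta> \<subseteq> X" using open_contains_ball by blast
  let ?B = "ball z1 \<delta>" and ?h = "\<lambda>z. \<kappa> (u z) / (1 - G z * \<kappa> (u z))"
  have BW: "?B \<subseteq> W" and B\<Omega>: "?B \<subseteq> \<Omega>" using \<delta> W\<Omega> by (auto simp: X_def)
  have uB: "u z \<in> ball w0 \<rho>" if "z \<in> ?B" for z using that BW by (auto simp: W_def)
  have nz: "1 - G z * \<kappa> (u z) \<noteq> 0" if "z \<in> ?B" for z
  proof -
    have "norm (G z * \<kappa> (u z)) < 1" using that \<delta> by (auto simp: X_def)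
    then show ?thesis by (metis norm_one eq_iff_diff_eq_0 less_irrefl)
  qed
  have der: "(\<kappa> has_field_derivative deriv \<kappa> (u z)) (at (u z))" if "z \<in> ?B" for z
    by (rule holomorphic_derivI[OF \<kappa>(1) open_ball uB[OF that]])
  have "?h holomorphic_on ?B"
  proof (rule looman_menchoff[OF open_ball])
    show "continuous_on ?B ?h"
      using nz by (intro continuous_intros continuous_on_subset[OF contk BW] continuous_on_subset[OF contGk BW]) auto
    let ?ex = "\<lambda>v z. (\<exists>d. has_partial_x v d z) \<and> (\<exists>d. has_partial_y v d z)"
    have "{z \<in> ?B. \<not> ?ex ?h z} \<subseteq> {z \<in> \<Omega>. \<not> ?ex u z} \<union> {z \<in> \<Omega>. \<not> ?ex G z}"
    proof (rule subsetI, rule ccontr)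
      fix z assume z: "z \<in> {z \<in> ?B. \<not> ?ex ?h z}" "z \<notin> {z \<in> \<Omega>. \<not> ?ex u z} \<union> {z \<in> \<Omega>. \<not> ?ex G z}"
      then have zB: "z \<in> ?B" and ex: "?ex u z" "?ex G z" using B\<Omega> by auto
      have "?ex ?h z"
        using ex has_partial_reciprocal_combination[of \<kappa> _ u z G, OF der[OF zB] nz[OF zB]] by blast
      with z show False by blast
    qed
    moreover have "countable ({z \<in> \<Omega>. \<not> ?ex u z} \<union> {z \<in> \<Omega>. \<not> ?ex G z})"
      using partu partG by (simp add: partials_exist_off_countable_def)
    ultimately show "partials_exist_off_countable ?h ?B"
      unfolding partials_exist_off_countable_def by (rule countable_subset)
    have "AE z in lebesgue_on ?B. has_dbar u (f (u z) * g z) z"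
      by (rule AE_lebesgue_on_open_subset[OF dbaru open_ball \<open>open \<Omega>\<close> B\<Omega>])
    moreover have "AE z in lebesgue_on ?B. has_dbar G (g z) z"
      by (rule AE_lebesgue_on_open_subset[OF dbarG open_ball \<open>open \<Omega>\<close> B\<Omega>])
    moreover have "AE z in lebesgue_on ?B. z \<in> ?B"
      by (rule AE_I2) simp
    ultimately show "AE z in lebesgue_on ?B. has_dbar ?h 0 z"
    proof eventually_elim
      case (elim z)
      have "deriv \<kappa> (u z) * (f (u z) * g z) + \<kappa> (u z) ^ 2 * g z = 0"
        using ode[OF uB[OF elim(3)]] by (simp flip: mult.assoc)
      then show ?case
        using has_dbar_reciprocal_combination[of \<kappa> _ u z G, OF der[OF elim(3)] nz[OF elim(3)] elim(1,2)]
        by simp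
    qed
  qed
  with \<delta> B\<Omega> uB nz show thesis by (intro that) auto
qed

theorem theorem4p9:
  fixes \<Omega>1 \<Omega>2 \<Omega>10 :: "complex set"
    and p r :: real
    and f g F G u :: "complex \<Rightarrow> complex"
    and z0 w0 :: complex
  assumes "open \<Omega>1" and "open \<Omega>2"
    and "p > 2" and "g \<in> Lp_loc p \<Omega>1"
    and "continuous_on \<Omega>1 G"
    and "partials_exist_off_countable G \<Omega>1"
    and "AE z in lebesgue_on \<Omega>1. has_dbar G (g z) z"
    and "continuous_on \<Omega>2 f"
    and "w0 \<in> \<Omega>2" and "f w0 = 0"
    and "r > 0" and "ball w0 r \<subseteq> \<Omega>2"
    and "F holomorphic_on ball w0 r - {w0}"
    and "\<forall>w \<in> ball w0 r - {w0}. f w \<noteq> 0 \<and> deriv F w = 1 / f w"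
    and "z0 \<in> \<Omega>1"
    and "open \<Omega>10" and "z0 \<in> \<Omega>10" and "\<Omega>10 \<subseteq> \<Omega>1"
    and "u ` \<Omega>10 \<subseteq> \<Omega>2"
    and "\<not> u constant_on connected_component_set \<Omega>10 z0"
    and "continuous_on \<Omega>10 u"
    and "partials_exist_off_countable u \<Omega>10"
    and "u z0 = w0"
    and "AE z in lebesgue_on \<Omega>10. has_dbar u (f (u z) * g z) z"
  shows "\<exists>M::nat. M \<ge> 1 \<and> (\<exists>U \<phi>. open U \<and> z0 \<in> U \<and> U \<subseteq> \<Omega>10 \<and>
           \<phi> holomorphic_on U \<and> (\<forall>z\<in>U. \<phi> z \<noteq> 0) \<and>
           (\<forall>z \<in> U - {z0}. u z \<in> ball w0 r - {w0} \<and>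
              (z - z0) ^ M * F (u z) = \<phi> z + (z - z0) ^ M * G z))"
proof -
  have pole: "is_pole F w0"
    by (rule is_pole_antiderivative[of r w0 f F]) (use assms in \<open>auto intro: continuous_on_subset\<close>)
  obtain \<rho> where \<rho>: "0 < \<rho>" "\<rho> \<le> r" "\<And>w. w \<in> ball w0 \<rho> - {w0} \<Longrightarrow> F w \<noteq> 0"
  proof -
    have "eventually (\<lambda>w. F w \<noteq> 0) (at w0)" by (rule non_zero_neighbour_pole[OF pole])
    then obtain d where d: "0 < d" "\<And>w. w \<noteq> w0 \<Longrightarrow> dist w w0 < d \<Longrightarrow> F w \<noteq> 0"
      by (auto simp: eventually_at)
    show thesis
      by (rule that[of "min d r"]) (use d \<open>r > 0\<close> in \<open>auto simp: dist_commute\<close>)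
  qed
  define \<kappa> where "\<kappa> w = (if w = w0 then 0 else inverse (F w))" for w
  have holF: "F holomorphic_on ball w0 \<rho> - {w0}"
    by (rule holomorphic_on_subset[OF assms(13)]) (use \<rho> in auto)
  have \<kappa>hol: "\<kappa> holomorphic_on ball w0 \<rho>"
    unfolding \<kappa>_def by (rule is_pole_inverse_holomorphic[OF open_ball holF pole]) (use \<rho> in auto)
  have \<kappa>0: "\<kappa> w0 = 0" by (simp add: \<kappa>_def)
  have \<kappa>_eq_0: "\<kappa> w = 0 \<longleftrightarrow> w = w0" if "w \<in> ball w0 \<rho>" for w
    using that \<rho>(3)[of w] by (auto simp: \<kappa>_def)
  have ode: "deriv \<kappa> w * f w = - (\<kappa> w ^ 2)" if w: "w \<in> ball w0 \<rho>" for w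
  proof (cases "w = w0")
    case True
    then show ?thesis using \<kappa>0 assms(10) by simp
  next
    case False
    then have w': "w \<in> ball w0 \<rho> - {w0}" using w by simp
    have fw: "f w \<noteq> 0" "deriv F w = 1 / f w" using assms(14) w' \<rho> by auto
    have op: "open (ball w0 \<rho> - {w0})" by auto
    have "((\<lambda>w. inverse (F w)) has_field_derivative - (inverse (F w) * deriv F w * inverse (F w))) (at w)"
      using \<rho>(3)[OF w'] by (intro DERIV_inverse' holomorphic_derivI[OF holF op w'])
    then have "(\<kappa> has_field_derivative - (inverse (F w) * deriv F w * inverse (F w))) (at w)"
      by (rule has_field_derivative_transform_within_open[OF _ op w']) (auto simp: \<kappa>_def)
    then have "deriv \<kappa> w = - (inverse (F w) * deriv F w * inverse (F w))" by (rule DERIV_imp_deriv)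
    then show ?thesis using fw False by (simp add: \<kappa>_def power2_eq_square)
  qed
  \<comment> \<open>Off the points with \<open>u z = w0\<close> this is \<open>1 / (F (u z) - G z)\<close>.\<close>
  define h where "h = (\<lambda>z. \<kappa> (u z) / (1 - G z * \<kappa> (u z)))"
  have local: "\<exists>\<delta>>0. ball z1 \<delta> \<subseteq> \<Omega>10 \<and> h holomorphic_on ball z1 \<delta> \<and>
      (\<forall>z\<in>ball z1 \<delta>. u z \<in> ball w0 \<rho> \<and> 1 - G z * \<kappa> (u z) \<noteq> 0 \<and> (h z = 0 \<longleftrightarrow> u z = w0))"
    if z1: "z1 \<in> \<Omega>10" "u z1 = w0" for z1
  proof -
    have contG: "continuous_on \<Omega>10 G" using assms(5,18) by (rule continuous_on_subset)
    have partG: "partials_exist_off_countable G \<Omega>10"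
      using assms(6,18) unfolding partials_exist_off_countable_def
      by (elim countable_subset[rotated]) auto
    have dbarG: "AE z in lebesgue_on \<Omega>10. has_dbar G (g z) z"
      by (rule AE_lebesgue_on_open_subset[OF assms(7,16,1,18)])
    obtain \<delta> where \<delta>: "0 < \<delta>" "ball z1 \<delta> \<subseteq> \<Omega>10" "h holomorphic_on ball z1 \<delta>"
      "\<And>z. z \<in> ball z1 \<delta> \<Longrightarrow> u z \<in> ball w0 \<rho> \<and> 1 - G z * \<kappa> (u z) \<noteq> 0"
    proof (rule holomorphic_reciprocal_combination[OF assms(16) z1 assms(21) contG assms(22) partG assms(24) dbarG \<rho>(1) \<kappa>hol \<kappa>0])
      show "deriv \<kappa> w * f w = - (\<kappa> w ^ 2)" if "w \<in> ball w0 \<rho>" for w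
        by (rule ode[OF that])
    next
      fix \<delta> assume "0 < \<delta>" "ball z1 \<delta> \<subseteq> \<Omega>10"
        "\<And>z. z \<in> ball z1 \<delta> \<Longrightarrow> u z \<in> ball w0 \<rho> \<and> 1 - G z * \<kappa> (u z) \<noteq> 0"
        "(\<lambda>z. \<kappa> (u z) / (1 - G z * \<kappa> (u z))) holomorphic_on ball z1 \<delta>"
      then show thesis by (intro that) (simp_all only: h_def)
    qed
    have "h z = 0 \<longleftrightarrow> u z = w0" if "z \<in> ball z1 \<delta>" for z
      using \<delta>(4)[OF that] \<kappa>_eq_0[of "u z"] by (simp add: h_def)
    with \<delta> show ?thesis by blast
  qed
  obtain \<delta> where \<delta>: "0 < \<delta>" "ball z0 \<delta> \<subseteq> \<Omega>10" "h holomorphic_on ball z0 \<delta>"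
    "\<And>z. z \<in> ball z0 \<delta> \<Longrightarrow> u z \<in> ball w0 \<rho> \<and> 1 - G z * \<kappa> (u z) \<noteq> 0 \<and> (h z = 0 \<longleftrightarrow> u z = w0)"
    using local[OF assms(17,23)] by blast
  have nonconst: "\<not> h constant_on ball z0 \<delta>"
  proof
    assume "h constant_on ball z0 \<delta>"
    then have "\<forall>z\<in>ball z0 \<delta>. u z = w0"
      using \<delta> assms(23) by (metis centre_in_ball constant_on_def)
    \<comment> \<open>The interior of the set where \<open>u = w0\<close>; it is also relatively closed, by analytic continuation of \<open>h\<close>.\<close>
    define A where "A = {z \<in> \<Omega>10. \<exists>e>0. ball z e \<subseteq> \<Omega>10 \<and> (\<forall>z'\<in>ball z e. u z' = w0)}"
    have "z0 \<in> A" using \<delta> \<open>\<forall>z\<in>ball z0 \<delta>. u z = w0\<close> assms(17) by (auto simp: A_def)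
    let ?C = "connected_component_set \<Omega>10 z0"
    have CC: "?C \<subseteq> \<Omega>10" by (rule connected_component_subset)
    have "open A"
      unfolding open_contains_ball
    proof
      fix z assume "z \<in> A"
      then obtain e where e: "0 < e" "ball z e \<subseteq> \<Omega>10" "\<forall>z'\<in>ball z e. u z' = w0" by (auto simp: A_def)
      have "ball z e \<subseteq> A"
      proof
        fix y assume y: "y \<in> ball z e"
        obtain e' where "0 < e'" "ball y e' \<subseteq> ball z e" using y open_ball open_contains_ball by blast
        with e y show "y \<in> A" unfolding A_def by blast
      qed
      with e show "\<exists>e>0. ball z e \<subseteq> A" by blast
    qed
    have Au: "u y = w0" if "y \<in> A" for y
    proof -
      from that obtain e where "0 < e" "\<forall>z'\<in>ball y e. u z' = w0" unfolding A_def by blast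
      then show ?thesis by simp
    qed
    have A\<Omega>: "A \<subseteq> \<Omega>10" unfolding A_def by blast
    have closed: "z \<in> A" if z: "z \<in> \<Omega>10" "z \<in> closure A" for z
    proof -
      have "closedin (top_of_set \<Omega>10) {x \<in> \<Omega>10. u x = w0}"
        by (rule continuous_closedin_preimage_constant[OF assms(21)])
      then have "\<exists>T. closed T \<and> {x \<in> \<Omega>10. u x = w0} = \<Omega>10 \<inter> T"
        by (simp only: closedin_closed)
      then obtain T where T: "closed T" "{x \<in> \<Omega>10. u x = w0} = \<Omega>10 \<inter> T"
        by (elim exE conjE)
      have "A \<subseteq> {x \<in> \<Omega>10. u x = w0}" using Au A\<Omega> by blast
      then have "A \<subseteq> T" unfolding T(2) by blast
      then have "closure A \<subseteq> T" using T(1) by (rule closure_minimal)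
      then have "z \<in> \<Omega>10 \<inter> T" using z by blast
      then have "u z = w0" unfolding T(2)[symmetric] by blast
      from local[OF z(1) this] obtain e where e: "0 < e" "ball z e \<subseteq> \<Omega>10" "h holomorphic_on ball z e"
        "\<And>y. y \<in> ball z e \<Longrightarrow> h y = 0 \<longleftrightarrow> u y = w0" by blast
      have "z \<in> closure A" by fact
      then obtain y where y: "y \<in> A" "dist y z < e" using e(1) closure_approachable by blast
      have op: "open (A \<inter> ball z e)" using \<open>open A\<close> by auto
      have yin: "y \<in> A \<inter> ball z e" using y by (simp add: dist_commute)
      have "h x = 0" if "x \<in> ball z e" for x
      proof (rule analytic_continuation_open[where s = "A \<inter> ball z e" and s' = "ball z e" and f = h and g = "\<lambda>_. 0"])
        show "A \<inter> ball z e \<noteq> {}" using yin by blast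
        show "h y = 0" if "y \<in> A \<inter> ball z e" for y
          using that e(4)[of y] Au[of y] by blast
      qed (use op e(3) that in auto)
      then have "\<forall>x\<in>ball z e. u x = w0" using e(4) by blast
      with e(1,2) z(1) show ?thesis unfolding A_def by blast
    qed
    have "?C \<subseteq> A"
    proof (rule ccontr)
      assume "\<not> ?C \<subseteq> A"
      have "?C \<inter> - closure A \<noteq> {}" using \<open>\<not> ?C \<subseteq> A\<close> closed CC by blast
      moreover have "z0 \<in> ?C" using assms(17) by simp
      moreover have "?C \<subseteq> A \<union> - closure A" using closed CC by blast
      moreover have "A \<inter> - closure A \<inter> ?C = {}" using closure_subset by blast
      moreover have "open (- closure A)" by auto
      ultimately show False
        using connectedD[OF connected_connected_component[of \<Omega>10 z0] \<open>open A\<close>, of "- closure A"] \<open>z0 \<in> A\<close> by blast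
    qed
    then have "u constant_on ?C"
      unfolding constant_on_def using Au by blast
    then show False using assms(20) by simp
  qed
  have "h z0 = 0" using \<delta>(4)[of z0] \<delta>(1) assms(23) by simp
  obtain \<psi> e M where \<psi>: "0 < M" "0 < e" "ball z0 e \<subseteq> ball z0 \<delta>" "\<psi> holomorphic_on ball z0 e"
      "\<And>z. z \<in> ball z0 e \<Longrightarrow> h z = (z - z0) ^ M * \<psi> z" "\<And>z. z \<in> ball z0 e \<Longrightarrow> \<psi> z \<noteq> 0"
    using holomorphic_factor_zero_nonconstant[OF \<delta>(3) open_ball connected_ball _ \<open>h z0 = 0\<close> nonconst] \<delta>(1)
    by (metis centre_in_ball)
  have "u z \<in> ball w0 r - {w0} \<and> (z - z0) ^ M * F (u z) = inverse (\<psi> z) + (z - z0) ^ M * G z"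
    if z: "z \<in> ball z0 e - {z0}" for z
  proof -
    have zd: "z \<in> ball z0 \<delta>" using z \<psi>(3) by blast
    have h: "h z = (z - z0) ^ M * \<psi> z" "\<psi> z \<noteq> 0" using \<psi>(5,6) z by auto
    then have "h z \<noteq> 0" using z by simp
    then have uw: "u z \<noteq> w0" "u z \<in> ball w0 \<rho>" and D: "1 - G z * \<kappa> (u z) \<noteq> 0" using \<delta>(4)[OF zd] by auto
    have Fnz: "F (u z) \<noteq> 0" using \<rho>(3) uw by blast
    have \<kappa>: "\<kappa> (u z) = inverse (F (u z))" using uw by (simp add: \<kappa>_def)
    have "inverse (h z) = F (u z) - G z"
      using Fnz D unfolding h_def \<kappa> by (simp add: field_simps)
    then have "(z - z0) ^ M * (F (u z) - G z) = (z - z0) ^ M * inverse (h z)" by simp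
    also have "\<dots> = inverse (\<psi> z)" using z unfolding h(1) by simp
    finally show ?thesis using uw \<rho>(2) by (simp add: algebra_simps)
  qed
  moreover have "(\<lambda>z. inverse (\<psi> z)) holomorphic_on ball z0 e"
    using \<psi> by (intro holomorphic_on_inverse) auto
  ultimately show ?thesis
    using \<psi>(1,2,3,6) \<delta>(2)
    by (intro exI[of _ M] conjI exI[of _ "ball z0 e"] exI[of _ "\<lambda>z. inverse (\<psi> z)"]) auto
qed

end
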